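(* Consider the homogeneous GPU rental problem without rescaling overheads with budget $b$, as set out in the context. The budget-optimal allocation (BOA) policy, i.e. the fixed-width policy whose widths $\{k_{ij}\}$ minimize the average JCT among fixed-width policies with operating budget at most $b$, is optimal: it minimizes the average JCT among all policies with operating budget at most $b$. It can be computed by solving the optimization problem $$ \begin{aligned} &\underset{\{k_{ij}\}}{\text{minimize}} && \text{average JCT}=\mathbb E[T]=\frac1\lambda\sum_{i}\lambda_i\sum_{j}\left(\frac{\mathbb E[X_{ij}]}{s_{ij}(k_{ij})}\right)\\ &\text{subject to} && \text{operating budget}=\sum_{i}\lambda_i\sum_{j}k_{ij}\left(\frac{\mathbb E[X_{ij}]}{s_{ij}(k_{ij})}\right)\le b,\\ &&& k_{ij}\ge \mathcal K_i . \end{aligned} $$ This is a convex optimization problem.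
   Context: **Jobs.** There are $M$ classes (types) of jobs, $i=1,\dots,M$. A type-$i$ job consists of $\ell_i$ epochs processed in order, and sums over $j$ run over $j=1,\dots,\ell_i$. Epoch $j$ of a type-$i$ job has random inherent work $X_{ij}$ with finite mean $\mathbb E[X_{ij}]$ and a speedup function $s_{ij}$ defined on $[\mathcal K_i,\infty)$ with positive values, where $\mathcal K_i>0$ is the minimum number of GPUs on which a type-$i$ job can run. While a type-$i$ job in epoch $j$ runs on $k\ge\mathcal K_i$ GPUs ($k$ may be fractional), its inherent work is processed at rate $s_{ij}(k)$. A job with no GPUs is queueing and makes no progress. A job completes when all its epochs are completed. **Speedup assumptions.** Each $s_{ij}$ is continuous on $[\mathcal K_i,\infty)$, non-decreasing, and concave, with $s_{ij}(k_1)/k_1\ge s_{ij}(k_2)/k_2$ for all $\mathcal K_i\le k_1<k_2$. **Arrivals.** Jobs arrive over time as an infinite stochastic sequence. Let $n_i(t)$ be the number of type-$i$ arrivals by time $t$, and $x_{ij}^{(\ell)}$ the inherent work of epoch $j$ of the $\ell$-th arriving type-$i$ job. The only distributional assumption is that time averages converge to finite means with probability 1: for all $i,j$, $\lim_{t\to\infty}n_i(t)/t=\lambda_i$ and $\lim_{t\to\infty}\frac{1}{n_i(t)}\sum_{\ell=1}^{n_i(t)}x_{ij}^{(\ell)}=\mathbb E[X_{ij}]$. Independence is not assumed. These averages are known to the customer. Put $\lambda=\sum_i\lambda_i$. **Policies.** A policy decides, at every time $t$, the number $K(t)$ of GPUs rented and how they are allocated to the jobs present in the system. There is a single type of GPU.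 Allocations and the number of rented GPUs can be changed instantaneously and without overhead (no rescaling overheads). **Metrics.** The job completion time (JCT) of a job is the time from its arrival to its completion. The average JCT, $\mathbb E[T]$, is the long-run average $\lim_{t\to\infty}\frac{1}{n(t)}\sum_{m=1}^{n(t)}T^{(m)}$, where $n(t)=\sum_i n_i(t)$ and $T^{(m)}$ is the JCT of the $m$-th arriving job. The operating budget (time-average cost) of a policy is $\lim_{t\to\infty}\frac1t\int_0^tK(s)\,ds$. The customer's budget $b$ is assumed high enough to keep up with the stream of jobs. **Fixed-width policy.** A fixed-width policy is parameterized by constants $\{k_{ij}\}$: it assigns $k_{ij}$ GPUs to every type-$i$ job for the entire duration of epoch $j$, without queueing (and rents exactly the GPUs so assigned).
   Formalization: The problem need not be convex in the widths k_ij (s(k)=√k makes the budget constraint non-convex); what is proved is that the average JCT is convex in k_ij and that the equivalent problem in the variables 1/s_ij(k_ij) is convex. *)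

theory Defs
  imports "HOL-Probability.Probability"
begin

section \<open>Rental instances\<close>

text \<open>
  Job classes are the elements of a finite type \<open>'c\<close>; \<open>'w\<close> is the sample space.  Jobs are numbered
  by \<open>m :: nat\<close> in order of arrival and epochs by \<open>j = 1, \<dots>, epochs R i\<close>.  The value
  \<open>work R m j w\<close> is the inherent work of epoch \<open>j\<close> of the \<open>m\<close>-th arriving job, of whatever class
  \<open>jclass R m w\<close> that job is; \<open>gen_work R i j\<close> is the generic work of epoch \<open>j\<close> of a class-\<open>i\<close> job, which
  enters only through its mean.
\<close>

record ('w, 'c) rental =
  sample :: "'w measure"
  epochs :: "'c \<Rightarrow> nat"
  kmin :: "'c \<Rightarrow> real"
  speed :: "'c \<Rightarrow> nat \<Rightarrow> real \<Rightarrow> real"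
  gen_work :: "'c \<Rightarrow> nat \<Rightarrow> 'w \<Rightarrow> real"
  rate :: "'c \<Rightarrow> real"
  arrival :: "nat \<Rightarrow> 'w \<Rightarrow> real"
  jclass :: "nat \<Rightarrow> 'w \<Rightarrow> 'c"
  work :: "nat \<Rightarrow> nat \<Rightarrow> 'w \<Rightarrow> real"

definition mean_work :: "('w, 'c) rental \<Rightarrow> 'c \<Rightarrow> nat \<Rightarrow> real" where
  "mean_work R i j = integral\<^sup>L (sample R) (gen_work R i j)"

definition total_rate :: "('w, 'c) rental \<Rightarrow> real" where
  "total_rate R = (\<Sum>i\<in>UNIV. rate R i)"

definition arrived :: "('w, 'c) rental \<Rightarrow> 'w \<Rightarrow> real \<Rightarrow> nat set" where
  "arrived R w t = {m. arrival R m w \<le> t}"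

definition arrived_class :: "('w, 'c) rental \<Rightarrow> 'w \<Rightarrow> 'c \<Rightarrow> real \<Rightarrow> nat set" where
  "arrived_class R w i t = {m \<in> arrived R w t. jclass R m w = i}"

locale gpu_rental =
  fixes R :: "('w, 'c::finite) rental"
  assumes prob_space_sample: "prob_space (sample R)"
    and epochs_pos: "\<And>i. 1 \<le> epochs R i"
    and kmin_pos: "\<And>i. 0 < kmin R i"
    and speed_pos: "\<And>i j k. j \<in> {1..epochs R i} \<Longrightarrow> kmin R i \<le> k \<Longrightarrow> 0 < speed R i j k"
    and speed_continuous: "\<And>i j. j \<in> {1..epochs R i} \<Longrightarrow> continuous_on {kmin R i..} (speed R i j)"
    and speed_mono: "\<And>i j. j \<in> {1..epochs R i} \<Longrightarrow> mono_on {kmin R i..} (speed R i j)"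
    and speed_concave: "\<And>i j. j \<in> {1..epochs R i} \<Longrightarrow> concave_on {kmin R i..} (speed R i j)"
    and speed_sublinear: "\<And>i j k1 k2. j \<in> {1..epochs R i} \<Longrightarrow> kmin R i \<le> k1 \<Longrightarrow> k1 < k2 \<Longrightarrow>
          speed R i j k1 / k1 \<ge> speed R i j k2 / k2"
    and gen_work_integrable: "\<And>i j. j \<in> {1..epochs R i} \<Longrightarrow> integrable (sample R) (gen_work R i j)"
    and gen_work_nonneg: "\<And>i j w. j \<in> {1..epochs R i} \<Longrightarrow> w \<in> space (sample R) \<Longrightarrow> 0 \<le> gen_work R i j w"
    and arrival_measurable: "\<And>m. arrival R m \<in> borel_measurable (sample R)"
    and jclass_measurable: "\<And>m. jclass R m \<in> measurable (sample R) (count_space UNIV)"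
    and work_measurable: "\<And>m j. work R m j \<in> borel_measurable (sample R)"
    and arrival_nonneg: "\<And>m w. w \<in> space (sample R) \<Longrightarrow> 0 \<le> arrival R m w"
    and arrival_incseq: "\<And>w. w \<in> space (sample R) \<Longrightarrow> incseq (\<lambda>m. arrival R m w)"
    and arrived_finite: "\<And>w t. w \<in> space (sample R) \<Longrightarrow> finite (arrived R w t)"
    and work_nonneg: "\<And>m j w. w \<in> space (sample R) \<Longrightarrow> 0 \<le> work R m j w"
    and arrival_average: "\<And>i. AE w in sample R.
          ((\<lambda>t. real (card (arrived_class R w i t)) / t) \<longlongrightarrow> rate R i) at_top"
    and work_average: "\<And>i j. j \<in> {1..epochs R i} \<Longrightarrow> AE w in sample R.
          ((\<lambda>t. (\<Sum>m\<in>arrived_class R w i t. work R m j w) / real (card (arrived_class R w i t)))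
             \<longlongrightarrow> mean_work R i j) at_top"
    and total_rate_pos: "0 < total_rate R"

section \<open>Policies and their metrics\<close>

text \<open>
  \<open>rented p w t\<close> is the number of GPUs rented at time \<open>t\<close>, and \<open>alloc p w m t\<close> is the number
  given to job \<open>m\<close>.
\<close>

record 'w policy =
  rented :: "'w \<Rightarrow> real \<Rightarrow> real"
  alloc :: "'w \<Rightarrow> nat \<Rightarrow> real \<Rightarrow> real"

definition proc_rate :: "('w, 'c) rental \<Rightarrow> 'c \<Rightarrow> nat \<Rightarrow> real \<Rightarrow> real" where
  "proc_rate R i j k = (if kmin R i \<le> k then speed R i j k else 0)"

text \<open>
  \<open>epoch_end R p w m j\<close> is the time at which job \<open>m\<close> has completed its first \<open>j\<close> epochs: the first
  time by which the work processed since the end of the previous epoch reaches the inherent work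
  of epoch \<open>j\<close>.  It is \<open>\<infinity>\<close> if this never happens, as \<open>Inf {} = \<infinity>\<close> in \<open>ereal\<close>.
\<close>

primrec epoch_end :: "('w, 'c) rental \<Rightarrow> 'w policy \<Rightarrow> 'w \<Rightarrow> nat \<Rightarrow> nat \<Rightarrow> ereal" where
  "epoch_end R p w m 0 = ereal (arrival R m w)"
| "epoch_end R p w m (Suc j) =
     Inf {ereal t | t. epoch_end R p w m j \<le> ereal t \<and>
       ennreal (work R m (Suc j) w) \<le>
         (\<integral>\<^sup>+u\<in>{u. epoch_end R p w m j \<le> ereal u \<and> u \<le> t}.
            ennreal (proc_rate R (jclass R m w) (Suc j) (alloc p w m u)) \<partial>lborel)}"

definition completion :: "('w, 'c) rental \<Rightarrow> 'w policy \<Rightarrow> 'w \<Rightarrow> nat \<Rightarrow> ereal" where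
  "completion R p w m = epoch_end R p w m (epochs R (jclass R m w))"

definition jct :: "('w, 'c) rental \<Rightarrow> 'w policy \<Rightarrow> 'w \<Rightarrow> nat \<Rightarrow> ereal" where
  "jct R p w m = completion R p w m - ereal (arrival R m w)"

definition policy :: "('w, 'c) rental \<Rightarrow> 'w policy \<Rightarrow> bool" where
  "policy R p \<longleftrightarrow> (\<forall>w\<in>space (sample R).
     rented p w \<in> borel_measurable borel \<and>
     (\<forall>m. alloc p w m \<in> borel_measurable borel) \<and>
     (\<forall>m t. alloc p w m t = 0 \<or> kmin R (jclass R m w) \<le> alloc p w m t) \<and>
     (\<forall>m t. alloc p w m t \<noteq> 0 \<longrightarrow> arrival R m w \<le> t \<and> ereal t < completion R p w m) \<and>
     (\<forall>t. (\<Sum>m\<in>arrived R w t. alloc p w m t) \<le> rented p w t))"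

text \<open>
  The metrics are the almost sure long-run limits.  They are allowed to depend on the sample path;
  a policy with deterministic metrics is the special case of constant functions \<open>T\<close> and \<open>C\<close>.
\<close>

definition has_average_jct :: "('w, 'c) rental \<Rightarrow> 'w policy \<Rightarrow> ('w \<Rightarrow> ereal) \<Rightarrow> bool" where
  "has_average_jct R p T \<longleftrightarrow> (AE w in sample R.
     ((\<lambda>t. (\<Sum>m\<in>arrived R w t. jct R p w m) / ereal (real (card (arrived R w t)))) \<longlongrightarrow> T w) at_top)"

definition has_operating_budget :: "('w, 'c) rental \<Rightarrow> 'w policy \<Rightarrow> ('w \<Rightarrow> ereal) \<Rightarrow> bool" where
  "has_operating_budget R p C \<longleftrightarrow> (AE w in sample R.
     ((\<lambda>t. enn2ereal (\<integral>\<^sup>+u\<in>{0..t}. ennreal (rented p w u) \<partial>lborel) / ereal t) \<longlongrightarrow> C w) at_top)"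

definition within_budget :: "('w, 'c) rental \<Rightarrow> real \<Rightarrow> 'w policy \<Rightarrow> bool" where
  "within_budget R b p \<longleftrightarrow>
     (\<exists>C. has_operating_budget R p C \<and> (AE w in sample R. C w \<le> ereal b))"

definition budget_keeps_up :: "('w, 'c) rental \<Rightarrow> real \<Rightarrow> bool" where
  "budget_keeps_up R b \<longleftrightarrow> (\<exists>p T. policy R p \<and> within_budget R b p \<and>
     has_average_jct R p T \<and> (AE w in sample R. T w < \<infinity>))"

definition minimizes_jct :: "('w, 'c) rental \<Rightarrow> real \<Rightarrow> 'w policy set \<Rightarrow> 'w policy \<Rightarrow> bool" where
  "minimizes_jct R b P p \<longleftrightarrow> p \<in> P \<and> within_budget R b p \<and>
     (\<exists>T. has_average_jct R p T \<and>
        (\<forall>q\<in>P. \<forall>T'. within_budget R b q \<longrightarrow> has_average_jct R q T' \<longrightarrow>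
           (AE w in sample R. T w \<le> T' w)))"

definition widths :: "('w, 'c) rental \<Rightarrow> ('c \<Rightarrow> nat \<Rightarrow> real) set" where
  "widths R = {k. \<forall>i. \<forall>j\<in>{1..epochs R i}. kmin R i \<le> k i j}"

text \<open>At most one summand below is nonzero: the one of the epoch in which job \<open>m\<close> is at time \<open>t\<close>.\<close>

definition fixed_width :: "('w, 'c) rental \<Rightarrow> ('c \<Rightarrow> nat \<Rightarrow> real) \<Rightarrow> 'w policy \<Rightarrow> bool" where
  "fixed_width R k p \<longleftrightarrow> policy R p \<and> k \<in> widths R \<and> (\<forall>w\<in>space (sample R).
     (\<forall>m t. alloc p w m t =
        (\<Sum>j\<in>{1..epochs R (jclass R m w)}.
           if epoch_end R p w m (j - 1) \<le> ereal t \<and> ereal t < epoch_end R p w m j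
           then k (jclass R m w) j else 0)) \<and>
     (\<forall>t. rented p w t = (\<Sum>m\<in>arrived R w t. alloc p w m t)))"

definition BOA :: "('w, 'c) rental \<Rightarrow> real \<Rightarrow> 'w policy \<Rightarrow> bool" where
  "BOA R b p \<longleftrightarrow> minimizes_jct R b {q. \<exists>k. fixed_width R k q} p"

section \<open>The optimization problem\<close>

definition width_jct :: "('w, 'c) rental \<Rightarrow> ('c \<Rightarrow> nat \<Rightarrow> real) \<Rightarrow> real" where
  "width_jct R k = 1 / total_rate R *
     (\<Sum>i\<in>UNIV. rate R i * (\<Sum>j = 1..epochs R i. mean_work R i j / speed R i j (k i j)))"

definition width_budget :: "('w, 'c) rental \<Rightarrow> ('c \<Rightarrow> nat \<Rightarrow> real) \<Rightarrow> real" where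
  "width_budget R k =
     (\<Sum>i\<in>UNIV. rate R i * (\<Sum>j = 1..epochs R i. k i j * (mean_work R i j / speed R i j (k i j))))"

definition solves :: "'a set \<Rightarrow> ('a \<Rightarrow> real) \<Rightarrow> ('a \<Rightarrow> real) \<Rightarrow> real \<Rightarrow> 'a \<Rightarrow> bool" where
  "solves S F G b x \<longleftrightarrow> x \<in> S \<and> G x \<le> b \<and> (\<forall>y\<in>S. G y \<le> b \<longrightarrow> F x \<le> F y)"

text \<open>
  Families \<open>'c \<Rightarrow> nat \<Rightarrow> real\<close> are not an instance of \<^class>\<open>real_vector\<close>, so convexity is spelled out.
\<close>

definition convex_fun ::
    "('c \<Rightarrow> nat \<Rightarrow> real) set \<Rightarrow> (('c \<Rightarrow> nat \<Rightarrow> real) \<Rightarrow> real) \<Rightarrow> bool" where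
  "convex_fun S F \<longleftrightarrow> (\<forall>x\<in>S. \<forall>y\<in>S. \<forall>u\<in>{0..1}.
     (\<lambda>i j. (1 - u) * x i j + u * y i j) \<in> S \<and>
     F (\<lambda>i j. (1 - u) * x i j + u * y i j) \<le> (1 - u) * F x + u * F y)"

text \<open>The problem of minimizing \<open>F\<close> over \<open>S\<close> subject to \<open>G \<le> b\<close>:\<close>

definition convex_problem ::
    "('c \<Rightarrow> nat \<Rightarrow> real) set \<Rightarrow> (('c \<Rightarrow> nat \<Rightarrow> real) \<Rightarrow> real) \<Rightarrow>
     (('c \<Rightarrow> nat \<Rightarrow> real) \<Rightarrow> real) \<Rightarrow> bool" where
  "convex_problem S F G \<longleftrightarrow> convex_fun S F \<and> convex_fun S G"

text \<open>
  The budget constraint is in general not convex in the widths: for \<open>s(k) = sqrt k\<close> a summand is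
  proportional to \<open>k / s(k) = sqrt k\<close>.  The problem is convex in the processing times per unit of
  work \<open>x i j = 1 / s(k i j)\<close>, in which the objective is linear.  As \<open>s\<close> may be constant from some
  width on, \<open>x i j\<close> need not determine \<open>k i j\<close>; the cost of \<open>x i j\<close> is then that of the cheapest
  width attaining it.
\<close>

definition unit_times :: "('w, 'c) rental \<Rightarrow> ('c \<Rightarrow> nat \<Rightarrow> real) \<Rightarrow> 'c \<Rightarrow> nat \<Rightarrow> real" where
  "unit_times R k = (\<lambda>i j. 1 / speed R i j (k i j))"

definition feasible_times :: "('w, 'c) rental \<Rightarrow> ('c \<Rightarrow> nat \<Rightarrow> real) set" where
  "feasible_times R = {x. \<forall>i. \<forall>j\<in>{1..epochs R i}. x i j \<in> (\<lambda>k. 1 / speed R i j k) ` {kmin R i..}}"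

definition unit_cost :: "('w, 'c) rental \<Rightarrow> 'c \<Rightarrow> nat \<Rightarrow> real \<Rightarrow> real" where
  "unit_cost R i j \<tau> = Inf {k / speed R i j k | k. kmin R i \<le> k \<and> 1 / speed R i j k = \<tau>}"

definition time_jct :: "('w, 'c) rental \<Rightarrow> ('c \<Rightarrow> nat \<Rightarrow> real) \<Rightarrow> real" where
  "time_jct R x = 1 / total_rate R *
     (\<Sum>i\<in>UNIV. rate R i * (\<Sum>j = 1..epochs R i. mean_work R i j * x i j))"

definition time_budget :: "('w, 'c) rental \<Rightarrow> ('c \<Rightarrow> nat \<Rightarrow> real) \<Rightarrow> real" where
  "time_budget R x =
     (\<Sum>i\<in>UNIV. rate R i * (\<Sum>j = 1..epochs R i. mean_work R i j * unit_cost R i j (x i j)))"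

end

(*
  If d + c k majorizes the speed of an epoch and touches it at a width k, then every policy needs, for
  work X, a duration D and a GPU time G with X <= d D + c G.  Pooling D and G over all jobs of a
  class completed by a large time t, the constant width max (kmin) (G / D) processes the same total
  work no slower and at no greater cost (Jensen).  Finite averages force every job arriving by time
  t to leave within o(t), so the pooled quantities converge to the time averages, and every policy
  within budget b yields widths whose objective and budget exceed its average JCT and b by
  arbitrarily little.  Compactness of truncated width families then gives widths within budget b.
*)

theory Submission
  imports Defs
begin

section \<open>Speedup functions\<close>

text \<open>Jensen's inequality is used through supporting lines because the rate as a function of
  the allocation is not concave: it is 0 below \<open>kmin\<close> and jumps there. A line d + c x
  with c and d nonnegative still dominates it, idle time included, and can be integrated along
  arbitrary allocation paths. Monotonicity of the speed gives c >= 0, that of the speed per GPU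
  gives d >= 0. Convexity of the cost in the unit time comes from the same pooling, applied to one
  unit of work split between two widths.

  The widths extracted from a policy may exceed the budget slightly, and they may run off to
  infinity as this excess tends to 0. Capping a width never raises its cost and, when the cost is
  bounded, lengthens durations only a little for a large cap; this makes compactness available.

  The definition of a fixed-width policy is circular: allocations are given by epoch ends, and epoch
  ends by allocations. A closed form of the epoch ends resolves this, both to construct such a
  policy and to find the metrics of every one.\<close>

context gpu_rental
begin

text \<open>Speed per GPU is largest at \<open>kmin\<close>, so the ray from the origin through the
  graph point at \<open>kmin\<close> stays above the graph.\<close>

lemma speed_le_linear:
  assumes "j \<in> {1..epochs R i}" "kmin R i \<le> x"
  shows "speed R i j x \<le> speed R i j (kmin R i) / kmin R i * x"
proof (cases "kmin R i = x")
  case False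
  then have "speed R i j x / x \<le> speed R i j (kmin R i) / kmin R i"
    using speed_sublinear[OF assms(1), of "kmin R i" x] assms(2) by simp
  moreover have "0 < x" using kmin_pos assms(2) by (metis less_le_trans)
  ultimately show ?thesis by (simp add: pos_divide_le_eq)
qed (use kmin_pos[of i] in simp)

text \<open>At an interior point the supporting line of the concave speed works, at
  \<open>kmin\<close> the ray through the origin. The signs of \<open>c\<close> and \<open>d\<close>
  let the line dominate the rate 0 of an idle job too.\<close>

lemma speed_affine_majorant:
  assumes "j \<in> {1..epochs R i}" and k: "kmin R i \<le> k"
  obtains c d where "0 \<le> c" "0 \<le> d" "d + c * k = speed R i j k"
    "\<And>x. kmin R i \<le> x \<Longrightarrow> speed R i j x \<le> d + c * x"
proof (cases "k = kmin R i")
  case True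
  let ?c = "speed R i j k / k"
  have "0 < k" using kmin_pos k by (metis less_le_trans)
  show thesis
  proof (rule that[of ?c 0])
    show "0 \<le> ?c" using speed_pos[OF assms] \<open>0 < k\<close> by simp
    show "0 + ?c * k = speed R i j k" using \<open>0 < k\<close> by simp
    show "speed R i j x \<le> 0 + ?c * x" if "kmin R i \<le> x" for x
      using speed_le_linear[OF assms(1) that] True by simp
  qed simp
next
  case False
  let ?I = "{kmin R i..}"
  let ?f = "\<lambda>x. - speed R i j x"
  \<comment> \<open>This is the right derivative of the speed at \<open>k\<close>, written as minus
    the infimum of the difference quotients of the negated, convex function.\<close>
  define c where "c = - Inf ((\<lambda>t. (?f k - ?f t) / (k - t)) ` ({k<..} \<inter> ?I))"
  have "0 < k" using kmin_pos k by (metis less_le_trans)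
  have "k \<in> interior ?I" using False k by simp
  have maj: "speed R i j x \<le> speed R i j k + c * (x - k)" if "kmin R i \<le> x" for x
    using convex_le_Inf_differential[of ?I ?f k x] speed_concave[OF assms(1)] \<open>k \<in> interior ?I\<close> that
    by (simp add: concave_on_def c_def)
  have "speed R i j k \<le> speed R i j (k + 1)"
    using speed_mono[OF assms(1)] k by (auto simp: mono_on_def)
  then have "0 \<le> c" using maj[of "k + 1"] k by simp
  let ?m = "kmin R i"
  have "?m < k" using False k by simp
  \<comment> \<open>At \<open>kmin\<close> the line lies above the graph, and the graph above the
    ray from the origin through the point at \<open>k\<close>. Since both lines meet at
    \<open>k\<close>, the slope of the first is at most that of the ray, so its intercept is
    nonnegative.\<close>
  have "speed R i j k * ?m / k \<le> speed R i j ?m"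
    using speed_sublinear[OF assms(1) _ \<open>?m < k\<close>] kmin_pos[of i] \<open>0 < k\<close> by (simp add: field_simps)
  also have "\<dots> \<le> speed R i j k + c * (?m - k)" by (rule maj) simp
  finally have "c * k * (k - ?m) \<le> speed R i j k * (k - ?m)" using \<open>0 < k\<close> by (simp add: field_simps)
  then have "c * k \<le> speed R i j k" using \<open>?m < k\<close> by simp
  show thesis
  proof (rule that[of c "speed R i j k - c * k"])
    show "speed R i j x \<le> speed R i j k - c * k + c * x" if "kmin R i \<le> x" for x
      using maj[OF that] by (simp add: algebra_simps)
  qed (use \<open>0 \<le> c\<close> \<open>c * k \<le> _\<close> in simp_all)
qed

lemma cost_mono:
  assumes "j \<in> {1..epochs R i}" "kmin R i \<le> k" "k \<le> k'"
  shows "k / speed R i j k \<le> k' / speed R i j k'"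
proof (cases "k = k'")
  case False
  have "0 < k" using kmin_pos assms(2) by (metis less_le_trans)
  have "speed R i j k' / k' \<le> speed R i j k / k"
    using speed_sublinear[OF assms(1,2)] assms(3) False by simp
  then show ?thesis
    using \<open>0 < k\<close> assms speed_pos[OF assms(1,2)] speed_pos[OF assms(1), of k']
    by (simp add: field_simps)
qed simp

text \<open>\<open>D\<close> is a total duration and \<open>G\<close> a total GPU time; by Jensen the constant width \<open>G / D\<close> is at
  least as fast, and below \<open>kmin\<close> the speed is compared with its chord through the origin.\<close>

lemma pooled_width:
  assumes j: "j \<in> {1..epochs R i}"
    and "0 \<le> D" "0 \<le> G" and G0: "D = 0 \<Longrightarrow> G = 0"
    and le: "\<And>c d. 0 \<le> c \<Longrightarrow> 0 \<le> d \<Longrightarrow> (\<And>x. kmin R i \<le> x \<Longrightarrow> speed R i j x \<le> d + c * x) \<Longrightarrow>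
      X \<le> d * D + c * G"
  obtains k where "kmin R i \<le> k" "X / speed R i j k \<le> D" "k * (X / speed R i j k) \<le> G"
proof (cases "kmin R i * D \<le> G \<and> D \<noteq> 0")
  case True
  define k where "k = G / D"
  have "0 < D" using True \<open>0 \<le> D\<close> by simp
  have k: "kmin R i \<le> k" using True \<open>0 < D\<close> by (simp add: k_def pos_le_divide_eq)
  obtain c d where cd: "0 \<le> c" "0 \<le> d" "d + c * k = speed R i j k"
      "\<And>x. kmin R i \<le> x \<Longrightarrow> speed R i j x \<le> d + c * x"
    using speed_affine_majorant[OF j k] by blast
  have G: "G = k * D" using \<open>0 < D\<close> by (simp add: k_def)
  have "X \<le> d * D + c * G" by (rule le) (use cd in auto)
  also have "\<dots> = speed R i j k * D" using cd(3)[symmetric] by (simp add: G algebra_simps)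
  finally have D: "X / speed R i j k \<le> D" using speed_pos[OF j k] by (simp add: divide_le_eq mult.commute)
  have "0 < k" using kmin_pos k by (metis less_le_trans)
  show thesis by (rule that[OF k D]) (use mult_left_mono[OF D, of k] G \<open>0 < k\<close> in simp)
next
  case small: False
  let ?m = "kmin R i"
  obtain c d where cd: "0 \<le> c" "0 \<le> d" "d + c * ?m = speed R i j ?m"
      "\<And>x. ?m \<le> x \<Longrightarrow> speed R i j x \<le> d + c * x"
    using speed_affine_majorant[OF j order_refl] by blast
  have "0 < ?m" "0 < speed R i j ?m" using kmin_pos speed_pos[OF j] by auto
  have "X \<le> 0 * D + speed R i j ?m / ?m * G"
    by (rule le) (use \<open>0 < ?m\<close> \<open>0 < speed R i j ?m\<close> speed_le_linear[OF j] in simp_all)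
  then have *: "?m * (X / speed R i j ?m) \<le> G"
    using \<open>0 < ?m\<close> \<open>0 < speed R i j ?m\<close> by (simp add: field_simps)
  have "X / speed R i j ?m \<le> D"
  proof (cases "D = 0")
    case True
    then have "X \<le> 0" using le[OF cd(1,2,4)] G0 by simp
    then show ?thesis using True \<open>0 < speed R i j ?m\<close> by (simp add: divide_nonpos_pos)
  next
    case False
    \<comment> \<open>The mean width is below \<open>kmin\<close>, so the bound on the GPU time at
      width \<open>kmin\<close> already implies the one on the duration.\<close>
    then have "G < ?m * D" using small by simp
    then have "?m * (X / speed R i j ?m) < ?m * D" using * by simp
    then show ?thesis using \<open>0 < ?m\<close> by (metis less_imp_le mult_less_cancel_left_pos)
  qed
  with * show thesis by (intro that[of ?m]) auto
qed

section \<open>The optimization problem\<close>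

text \<open>A rate is a limit of nonnegative quotients on almost every path, and a probability space
  has at least one such path.\<close>

lemma rate_nonneg: "0 \<le> rate R i"
proof -
  interpret prob_space "sample R" by (rule prob_space_sample)
  have ae_filter_not_bot: "ae_filter (sample R) \<noteq> bot"
    using emeasure_space_1 by (metis ae_filter_eq_bot_iff zero_neq_one)
  obtain w where "((\<lambda>t. real (card (arrived_class R w i t)) / t) \<longlongrightarrow> rate R i) at_top"
    using eventually_happens'[OF ae_filter_not_bot arrival_average[of i]] by blast
  moreover have "\<forall>\<^sub>F t in at_top. 0 \<le> real (card (arrived_class R w i t)) / t"
    using eventually_ge_at_top[of 0] by eventually_elim simp
  ultimately show ?thesis by (rule tendsto_lowerbound) simp
qed

lemma mean_work_nonneg: "j \<in> {1..epochs R i} \<Longrightarrow> 0 \<le> mean_work R i j"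
  unfolding mean_work_def using gen_work_nonneg by (intro Bochner_Integration.integral_nonneg)

text \<open>The work of epoch \<open>j\<close> of class \<open>i\<close> that arrives per unit of
  time in the long run; objective and budget are sums weighted by these numbers.\<close>

definition load :: "'c \<Rightarrow> nat \<Rightarrow> real" where
  "load i j = rate R i * mean_work R i j"

lemma load_nonneg: "j \<in> {1..epochs R i} \<Longrightarrow> 0 \<le> load i j"
  by (simp add: load_def rate_nonneg mean_work_nonneg)

lemma width_jct_eq:
  "width_jct R k = (\<Sum>i\<in>UNIV. \<Sum>j = 1..epochs R i. load i j * (1 / speed R i j (k i j))) / total_rate R"
  by (simp add: width_jct_def load_def sum_distrib_left sum_divide_distrib mult_ac)

lemma width_budget_eq:
  "width_budget R k = (\<Sum>i\<in>UNIV. \<Sum>j = 1..epochs R i. load i j * (k i j / speed R i j (k i j)))"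
  by (simp add: width_budget_def load_def sum_distrib_left mult_ac)

lemma time_jct_eq:
  "time_jct R x = (\<Sum>i\<in>UNIV. \<Sum>j = 1..epochs R i. load i j * x i j) / total_rate R"
  by (simp add: time_jct_def load_def sum_distrib_left sum_divide_distrib mult_ac)

lemma time_budget_eq:
  "time_budget R x = (\<Sum>i\<in>UNIV. \<Sum>j = 1..epochs R i. load i j * unit_cost R i j (x i j))"
  by (simp add: time_budget_def load_def sum_distrib_left mult.assoc)

lemma load_sum_mono:
  assumes "\<And>i j. j \<in> {1..epochs R i} \<Longrightarrow> f i j \<le> g i j"
  shows "(\<Sum>i\<in>UNIV. \<Sum>j = 1..epochs R i. load i j * f i j) \<le>
    (\<Sum>i\<in>UNIV. \<Sum>j = 1..epochs R i. load i j * g i j)"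
  by (intro sum_mono mult_left_mono assms load_nonneg)

lemma load_sum_combination:
  "(\<Sum>i\<in>UNIV. \<Sum>j = 1..epochs R i. load i j * ((1 - u) * f i j + u * g i j)) =
    (1 - u) * (\<Sum>i\<in>UNIV. \<Sum>j = 1..epochs R i. load i j * f i j) +
    u * (\<Sum>i\<in>UNIV. \<Sum>j = 1..epochs R i. load i j * g i j)"
  by (simp only: distrib_left sum.distrib sum_distrib_left mult.left_commute)

text \<open>The reciprocal is decreasing and convex on the positive reals, hence convex after a
  positive concave function.\<close>

lemma inverse_speed_convex:
  assumes "j \<in> {1..epochs R i}"
  shows "convex_on {kmin R i..} (\<lambda>k. 1 / speed R i j k)"
proof (rule convex_onI)
  fix t x y :: real assume t: "0 < t" "t < 1" and xy: "x \<in> {kmin R i..}" "y \<in> {kmin R i..}"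
  let ?a = "speed R i j x" and ?b = "speed R i j y"
  have ab: "0 < ?a" "0 < ?b" using xy speed_pos[OF assms] by auto
  have "convex_on {0<..} (inverse :: real \<Rightarrow> real)" by (rule convex_on_inverse) auto
  from convex_onD[OF this, of t ?a ?b]
  have "inverse ((1 - t) * ?a + t * ?b) \<le> (1 - t) * inverse ?a + t * inverse ?b"
    using t ab by simp
  moreover have "(1 - t) * ?a + t * ?b \<le> speed R i j ((1 - t) *\<^sub>R x + t *\<^sub>R y)"
    using concave_onD[OF speed_concave[OF assms], of t x y] t xy by simp
  moreover have "0 < (1 - t) * ?a + t * ?b" using t ab by (simp add: add_pos_pos)
  moreover note le_imp_inverse_le[of "(1 - t) * ?a + t * ?b" "speed R i j ((1 - t) *\<^sub>R x + t *\<^sub>R y)"]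
  ultimately show "1 / speed R i j ((1 - t) *\<^sub>R x + t *\<^sub>R y) \<le> (1 - t) * (1 / ?a) + t * (1 / ?b)"
    by (simp add: inverse_eq_divide)
qed simp

lemma convex_width_jct: "convex_fun (widths R) (width_jct R)"
  unfolding convex_fun_def
proof (intro ballI conjI)
  fix x y u assume xy: "x \<in> widths R" "y \<in> widths R" and u: "u \<in> {0..1::real}"
  let ?z = "\<lambda>i j. (1 - u) * x i j + u * y i j"
  show "?z \<in> widths R"
    unfolding widths_def
  proof (intro CollectI allI ballI)
    fix i j assume j: "j \<in> {1..epochs R i}"
    have "(1 - u) * kmin R i + u * kmin R i \<le> ?z i j"
      using xy j u by (intro add_mono mult_left_mono) (auto simp: widths_def)
    then show "kmin R i \<le> ?z i j" by (simp add: algebra_simps)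
  qed
  have "1 / speed R i j (?z i j) \<le> (1 - u) * (1 / speed R i j (x i j)) + u * (1 / speed R i j (y i j))"
    if "j \<in> {1..epochs R i}" for i j
    using convex_onD[OF inverse_speed_convex[OF that], of u "x i j" "y i j"] xy u that
    by (simp add: widths_def)
  from load_sum_mono[of "\<lambda>i j. 1 / speed R i j (?z i j)", OF this]
  show "width_jct R ?z \<le> (1 - u) * width_jct R x + u * width_jct R y"
    using total_rate_pos
    unfolding load_sum_combination[of u "\<lambda>i j. 1 / speed R i j (x i j)" "\<lambda>i j. 1 / speed R i j (y i j)"]
      width_jct_eq times_divide_eq_right[of _ _ "total_rate R"] add_divide_distrib[symmetric]
    by (intro divide_right_mono) simp_all
qed

section \<open>Unit times and the cheapest widths that attain them\<close>

lemma unit_cost_le: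
  assumes "kmin R i \<le> k" "0 < speed R i j k"
  shows "unit_cost R i j (1 / speed R i j k) \<le> k / speed R i j k"
  unfolding unit_cost_def
proof (rule cInf_lower)
  show "bdd_below {k' / speed R i j k' |k'. kmin R i \<le> k' \<and> 1 / speed R i j k' = 1 / speed R i j k}"
    using assms(2) kmin_pos[of i] by (intro bdd_belowI[of _ 0]) (auto intro!: divide_nonneg_nonneg)
qed (use assms in blast)

text \<open>By continuity the widths with a given unit time form a closed set, bounded below by
  \<open>kmin\<close>. Its least element is the cheapest width, because cost grows with
  width.\<close>

lemma unit_cost_attained:
  assumes j: "j \<in> {1..epochs R i}" and \<tau>: "\<tau> \<in> (\<lambda>k. 1 / speed R i j k) ` {kmin R i..}"
  obtains k where "kmin R i \<le> k" "1 / speed R i j k = \<tau>" "unit_cost R i j \<tau> = k / speed R i j k"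
proof -
  let ?S = "{k \<in> {kmin R i..}. speed R i j k = 1 / \<tau>}"
  have "?S \<noteq> {}" using \<tau> by auto
  have "closed ?S"
    by (rule continuous_closed_preimage_constant[OF speed_continuous[OF j]]) simp
  have "bdd_below ?S" by (intro bdd_belowI[of _ "kmin R i"]) auto
  define k where "k = Inf ?S"
  have kS: "k \<in> ?S"
    unfolding k_def by (rule closed_contains_Inf[OF \<open>?S \<noteq> {}\<close> \<open>bdd_below ?S\<close> \<open>closed ?S\<close>])
  have k: "kmin R i \<le> k" "1 / speed R i j k = \<tau>" using kS by auto
  have "k / speed R i j k \<le> unit_cost R i j \<tau>"
    unfolding unit_cost_def
  proof (rule cInf_greatest)
    fix c assume "c \<in> {k / speed R i j k |k. kmin R i \<le> k \<and> 1 / speed R i j k = \<tau>}"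
    then obtain k' where k': "c = k' / speed R i j k'" "kmin R i \<le> k'" "1 / speed R i j k' = \<tau>" by auto
    have "k' \<in> ?S" using k' by auto
    then have "k \<le> k'" unfolding k_def using \<open>bdd_below ?S\<close> by (rule cInf_lower)
    then show "k / speed R i j k \<le> c" unfolding k'(1) by (rule cost_mono[OF j k(1)])
  qed (use k in auto)
  moreover have "unit_cost R i j \<tau> \<le> k / speed R i j k"
    using unit_cost_le[OF k(1) speed_pos[OF j k(1)]] k(2) by simp
  ultimately show thesis using that k by force
qed

text \<open>Doing the fraction 1 - u of one unit of work at width \<open>k\<close> and the fraction
  u at width \<open>l\<close> takes time \<open>z\<close> and GPU time \<open>G\<close>. Pooling
  replaces the two widths by a single one that is no slower and no dearer.\<close>

lemma unit_cost_convex: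
  assumes j: "j \<in> {1..epochs R i}"
  defines "I \<equiv> (\<lambda>k. 1 / speed R i j k) ` {kmin R i..}"
  assumes x: "x \<in> I" and y: "y \<in> I" and u: "0 \<le> u" "u \<le> 1"
  shows "(1 - u) * x + u * y \<in> I"
    and "unit_cost R i j ((1 - u) * x + u * y) \<le> (1 - u) * unit_cost R i j x + u * unit_cost R i j y"
proof -
  let ?s = "speed R i j"
  define z where "z = (1 - u) * x + u * y"
  obtain k where k: "kmin R i \<le> k" "1 / ?s k = x" "unit_cost R i j x = k / ?s k"
    using unit_cost_attained[OF j] x unfolding I_def by blast
  obtain l where l: "kmin R i \<le> l" "1 / ?s l = y" "unit_cost R i j y = l / ?s l"
    using unit_cost_attained[OF j] y unfolding I_def by blast
  have sk: "0 < ?s k" "0 < ?s l" using k l speed_pos[OF j] by auto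
  have xy: "0 < x" "0 < y" using k l sk by auto
  have kl: "0 < k" "0 < l" using k l kmin_pos by (metis less_le_trans)+
  define G where "G = (1 - u) * unit_cost R i j x + u * unit_cost R i j y"
  have zpos: "0 < z" unfolding z_def using u xy
    by (cases "u = 0") (auto intro!: add_nonneg_pos)
  have G0: "0 \<le> G" unfolding G_def using u k l kl sk by (auto intro!: add_nonneg_nonneg mult_nonneg_nonneg)
  \<comment> \<open>Pooling with work 1, duration \<open>z\<close> and GPU time \<open>G\<close>: a
    majorant holds at \<open>k\<close> and at \<open>l\<close>, hence for the mixture.\<close>
  obtain h where h: "kmin R i \<le> h" "1 / ?s h \<le> z" "h * (1 / ?s h) \<le> G"
  proof (rule pooled_width[OF j, of z G 1])
    fix c d assume cd: "0 \<le> c" "0 \<le> d" and maj: "\<And>v. kmin R i \<le> v \<Longrightarrow> ?s v \<le> d + c * v"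
    have 1: "1 \<le> d * x + c * (k / ?s k)" "1 \<le> d * y + c * (l / ?s l)"
      using maj[OF k(1)] maj[OF l(1)] sk unfolding k(2)[symmetric] l(2)[symmetric]
      by (simp_all add: field_simps)
    have "1 = (1 - u) * 1 + u * 1" by simp
    also have "\<dots> \<le> (1 - u) * (d * x + c * (k / ?s k)) + u * (d * y + c * (l / ?s l))"
      using u 1 by (intro add_mono mult_left_mono) auto
    also have "\<dots> = d * z + c * G" by (simp add: z_def G_def k(3) l(3) algebra_simps)
    finally show "1 \<le> d * z + c * G" .
  qed (use zpos G0 that in auto)
  have "0 < ?s h" using h speed_pos[OF j] by auto
  then have "1 / z \<le> ?s h" using h(2) zpos by (simp add: field_simps)
  have smono: "?s (kmin R i) \<le> ?s v" if "kmin R i \<le> v" for v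
    using speed_mono[OF j] that by (auto simp: mono_on_def)
  have s0: "0 < ?s (kmin R i)" using speed_pos[OF j] by simp
  have "x \<le> 1 / ?s (kmin R i)" "y \<le> 1 / ?s (kmin R i)"
    unfolding k(2)[symmetric] l(2)[symmetric] using smono k(1) l(1) s0 sk
    by (auto intro!: divide_left_mono)
  then have "z \<le> (1 - u) * (1 / ?s (kmin R i)) + u * (1 / ?s (kmin R i))"
    unfolding z_def using u by (intro add_mono mult_left_mono) auto
  then have "z \<le> 1 / ?s (kmin R i)" by (simp add: algebra_simps diff_divide_distrib)
  then have "?s (kmin R i) \<le> 1 / z" using s0 zpos by (simp add: field_simps)
  \<comment> \<open>Width \<open>h\<close> may be faster than required. As \<open>z\<close> is at
    most the unit time at \<open>kmin\<close>, some width between \<open>kmin\<close> and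
    \<open>h\<close> has unit time exactly \<open>z\<close>, and being narrower it costs no more
    than \<open>h\<close>.\<close>
  then obtain v where v: "kmin R i \<le> v" "v \<le> h" "?s v = 1 / z"
    using IVT'[of ?s "kmin R i" "1 / z" h] \<open>1 / z \<le> ?s h\<close> h(1)
      continuous_on_subset[OF speed_continuous[OF j], of "{kmin R i..h}"] by auto
  have zv: "z = 1 / ?s v" using v(3) by simp
  show "(1 - u) * x + u * y \<in> I" unfolding I_def z_def[symmetric] using zv v(1) by auto
  have "unit_cost R i j z \<le> v / ?s v"
    unfolding zv by (rule unit_cost_le) (use v(1) speed_pos[OF j v(1)] in auto)
  also have "\<dots> \<le> h / ?s h" by (rule cost_mono[OF j v(1,2)])
  also have "\<dots> \<le> G" using h(3) by simp
  finally show "unit_cost R i j ((1 - u) * x + u * y) \<le> (1 - u) * unit_cost R i j x + u * unit_cost R i j y"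
    unfolding z_def G_def .
qed

lemma convex_time_problem: "convex_problem (feasible_times R) (time_jct R) (time_budget R)"
proof -
  have feas: "(\<lambda>i j. (1 - u) * x i j + u * y i j) \<in> feasible_times R"
    if "x \<in> feasible_times R" "y \<in> feasible_times R" "u \<in> {0..1}" for x y u
    using that unit_cost_convex(1) unfolding feasible_times_def by simp
  have "time_budget R (\<lambda>i j. (1 - u) * x i j + u * y i j) \<le> (1 - u) * time_budget R x + u * time_budget R y"
    if "x \<in> feasible_times R" "y \<in> feasible_times R" "u \<in> {0..1}" for x y u
    unfolding time_budget_eq load_sum_combination[symmetric]
    using that unit_cost_convex(2) unfolding feasible_times_def by (intro load_sum_mono) simp
  moreover have "time_jct R (\<lambda>i j. (1 - u) * x i j + u * y i j) = (1 - u) * time_jct R x + u * time_jct R y" for x y u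
    unfolding time_jct_eq load_sum_combination by (simp add: add_divide_distrib)
  ultimately show ?thesis unfolding convex_problem_def convex_fun_def using feas by auto
qed

lemma unit_times_feasible: "k \<in> widths R \<Longrightarrow> unit_times R k \<in> feasible_times R"
  by (auto simp: widths_def feasible_times_def unit_times_def)

lemma time_jct_unit_times: "time_jct R (unit_times R k) = width_jct R k"
  by (simp add: time_jct_eq width_jct_eq unit_times_def)

lemma time_budget_unit_times: "k \<in> widths R \<Longrightarrow> time_budget R (unit_times R k) \<le> width_budget R k"
  unfolding time_budget_eq width_budget_eq unit_times_def
  by (intro load_sum_mono unit_cost_le) (auto simp: widths_def speed_pos)

text \<open>Choosing the cheapest width for each unit time makes the two budgets equal; an arbitrary
  family of widths only gives \<open>time_budget_unit_times\<close>. The last conclusion is limited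
  to actual epochs, as feasibility leaves the other entries of \<open>x\<close> arbitrary.\<close>

lemma feasible_times_width:
  assumes "x \<in> feasible_times R"
  obtains k where "k \<in> widths R" "width_budget R k = time_budget R x" "width_jct R k = time_jct R x"
    "\<forall>i. \<forall>j\<in>{1..epochs R i}. x i j = unit_times R k i j"
proof -
  define k where "k = (\<lambda>i j. SOME v. kmin R i \<le> v \<and> 1 / speed R i j v = x i j \<and>
    unit_cost R i j (x i j) = v / speed R i j v)"
  have *: "kmin R i \<le> k i j \<and> 1 / speed R i j (k i j) = x i j \<and>
      unit_cost R i j (x i j) = k i j / speed R i j (k i j)" if j: "j \<in> {1..epochs R i}" for i j
  proof -
    have "x i j \<in> (\<lambda>k. 1 / speed R i j k) ` {kmin R i..}"
      using assms j by (simp add: feasible_times_def)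
    then obtain v where "kmin R i \<le> v \<and> 1 / speed R i j v = x i j \<and>
        unit_cost R i j (x i j) = v / speed R i j v"
      using unit_cost_attained[OF j] by blast
    then show ?thesis unfolding k_def by (rule someI)
  qed
  have k: "kmin R i \<le> k i j" "1 / speed R i j (k i j) = x i j"
      "unit_cost R i j (x i j) = k i j / speed R i j (k i j)" if "j \<in> {1..epochs R i}" for i j
    using *[OF that] by auto
  show thesis
  proof (rule that[of k])
    show "k \<in> widths R" using k by (simp add: widths_def)
    show "width_budget R k = time_budget R x" unfolding width_budget_eq time_budget_eq by (simp add: k)
    show "width_jct R k = time_jct R x" unfolding width_jct_eq time_jct_eq by (simp add: k)
    show "\<forall>i. \<forall>j\<in>{1..epochs R i}. x i j = unit_times R k i j"
      using k(2) by (simp add: unit_times_def)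
  qed
qed

lemma feasible_times_cong:
  assumes "\<And>i j. j \<in> {1..epochs R i} \<Longrightarrow> x i j = y i j"
  shows "time_budget R x = time_budget R y" "x \<in> feasible_times R \<longleftrightarrow> y \<in> feasible_times R"
  using assms by (simp_all add: time_budget_eq feasible_times_def)

lemma feasible_set_eq:
  "{x \<in> feasible_times R. time_budget R x \<le> b} =
     {x. \<exists>k\<in>widths R. width_budget R k \<le> b \<and>
           (\<forall>i. \<forall>j\<in>{1..epochs R i}. x i j = unit_times R k i j)}" (is "?A = ?B")
proof (intro set_eqI iffI)
  fix x assume "x \<in> ?A"
  then have x: "x \<in> feasible_times R" "time_budget R x \<le> b" by auto
  from x(1) obtain k where "k \<in> widths R" "width_budget R k = time_budget R x" "width_jct R k = time_jct R x"
    "\<forall>i. \<forall>j\<in>{1..epochs R i}. x i j = unit_times R k i j" by (rule feasible_times_width)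
  with x(2) show "x \<in> ?B" by (intro CollectI bexI[of _ k]) auto
next
  fix x assume "x \<in> ?B"
  then obtain k where k: "k \<in> widths R" "width_budget R k \<le> b"
    "\<And>i j. j \<in> {1..epochs R i} \<Longrightarrow> x i j = unit_times R k i j" by blast
  have "x \<in> feasible_times R"
    using feasible_times_cong(2)[of x "unit_times R k", OF k(3)] unit_times_feasible[OF k(1)] by blast
  moreover have "time_budget R x \<le> b"
    using feasible_times_cong(1)[of x "unit_times R k", OF k(3)] time_budget_unit_times[OF k(1)] k(2) by linarith
  ultimately show "x \<in> ?A" by simp
qed

text \<open>Feasible points of either problem have counterparts in the other with the same
  objective, so both have the same optimal value, and optimality of \<open>k\<close> and of its unit
  times are the same condition.\<close>

lemma solves_iff:
  assumes k: "k \<in> widths R" "width_budget R k \<le> b"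
  shows "solves (widths R) (width_jct R) (width_budget R) b k \<longleftrightarrow>
    solves (feasible_times R) (time_jct R) (time_budget R) b (unit_times R k)"
proof
  assume L: "solves (widths R) (width_jct R) (width_budget R) b k"
  show "solves (feasible_times R) (time_jct R) (time_budget R) b (unit_times R k)"
    unfolding solves_def
  proof (intro conjI ballI impI)
    show "unit_times R k \<in> feasible_times R" by (rule unit_times_feasible[OF k(1)])
    show "time_budget R (unit_times R k) \<le> b" using time_budget_unit_times[OF k(1)] k(2) by simp
    fix y assume y: "y \<in> feasible_times R" "time_budget R y \<le> b"
    from y(1) obtain l where
      "l \<in> widths R" "width_budget R l = time_budget R y" "width_jct R l = time_jct R y"
      by (rule feasible_times_width)
    with L y(2) show "time_jct R (unit_times R k) \<le> time_jct R y"
      unfolding time_jct_unit_times solves_def by auto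
  qed
next
  assume r: "solves (feasible_times R) (time_jct R) (time_budget R) b (unit_times R k)"
  have "width_jct R k \<le> width_jct R l" if "l \<in> widths R" "width_budget R l \<le> b" for l
    using r unit_times_feasible[OF that(1)] time_budget_unit_times[OF that(1)] that(2)
    unfolding solves_def time_jct_unit_times[symmetric] by (meson order_trans)
  then show "solves (widths R) (width_jct R) (width_budget R) b k"
    using k by (simp add: solves_def)
qed

end

section \<open>Time averages and approximate optima\<close>

text \<open>Applied with c = 1 - \<epsilon>, to count only the jobs that arrived early enough to
  have left by time \<open>t\<close>.\<close>

lemma tendsto_time_scale:
  fixes f :: "real \<Rightarrow> real"
  assumes "((\<lambda>t. f t / t) \<longlongrightarrow> L) at_top" "0 < c"
  shows "((\<lambda>t. f (c * t) / t) \<longlongrightarrow> c * L) at_top"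
proof -
  have "filterlim (\<lambda>t. c * t) at_top at_top"
    using filterlim_tendsto_pos_mult_at_top[OF tendsto_const assms(2) filterlim_ident] .
  from tendsto_mult[OF tendsto_const[of c] filterlim_compose[OF assms(1) this]]
  show ?thesis
    by (rule Lim_transform_eventually)
      (use assms(2) in \<open>auto intro!: eventually_mono[OF eventually_gt_at_top[of 0]]\<close>)
qed

text \<open>A sojourn of length \<open>\<epsilon> t\<close> would make the total jump by a multiple of \<open>t\<close>.\<close>

lemma eventually_sojourn_le:
  fixes A T :: "nat \<Rightarrow> real"
  assumes fin: "\<And>t. finite {m. A m \<le> t}" and nonneg: "\<And>m. 0 \<le> T m"
    and lim: "((\<lambda>t. (\<Sum>m | A m \<le> t. T m) / t) \<longlongrightarrow> \<sigma>) at_top" and "0 < \<epsilon>"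
  shows "\<forall>\<^sub>F t in at_top. \<forall>m. A m \<le> t \<longrightarrow> T m \<le> \<epsilon> * t"
proof -
  define S where "S = (\<lambda>t. \<Sum>m | A m \<le> t. T m)"
  \<comment> \<open>A jump over a unit interval ending at time \<open>A m\<close> is at most the
    absolute value of \<open>\<sigma>\<close> plus 2 \<eta> \<open>A m\<close>; with \<eta> =
    \<epsilon> / 4 and \<open>t\<close> large, each of the two terms is at most \<epsilon> t /
    2.\<close>
  define \<eta> where "\<eta> = \<epsilon> / 4"
  have "0 < \<eta>" using \<open>0 < \<epsilon>\<close> by (simp add: \<eta>_def)
  have "\<forall>\<^sub>F t in at_top. 0 < t \<and> dist (S t / t) \<sigma> < \<eta>"
    using tendstoD[OF lim \<open>0 < \<eta>\<close>] eventually_gt_at_top[of 0] unfolding S_def by eventually_elim simp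
  then obtain t0 where t0: "\<And>t. t0 \<le> t \<Longrightarrow> 0 < t \<and> dist (S t / t) \<sigma> < \<eta>"
    unfolding eventually_at_top_linorder by blast
  have near: "S t \<le> (\<sigma> + \<eta>) * t" "(\<sigma> - \<eta>) * t \<le> S t" if "t0 \<le> t" for t
    using t0[OF that] by (auto simp: dist_real_def abs_less_iff field_simps)
  have le: "T m \<le> S t" if "A m \<le> t" for m t
    unfolding S_def using that nonneg by (intro member_le_sum fin) auto
  \<comment> \<open>Stepping back by a whole unit of time surely excludes \<open>m\<close> from the
    earlier sum, with no left limits and no distinction of simultaneous arrivals.\<close>
  have jump: "T m \<le> S (A m) - S (A m - 1)" for m
  proof -
    have "S (A m - 1) + T m = sum T (insert m {n. A n \<le> A m - 1})"
      unfolding S_def using fin by simp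
    also have "\<dots> \<le> S (A m)" unfolding S_def using fin nonneg by (intro sum_mono2) auto
    finally show ?thesis by simp
  qed
  \<comment> \<open>Late arrivals are bounded through the jump. Arrivals before
    \<open>t0 + 1\<close> are bounded by the constant \<open>S (t0 + 1)\<close>, which \<epsilon> t
    eventually exceeds.\<close>
  have "\<forall>\<^sub>F t in at_top. t0 + 1 \<le> t \<and> \<bar>S (t0 + 1)\<bar> / \<epsilon> \<le> t \<and> 2 * \<bar>\<sigma>\<bar> / \<epsilon> \<le> t"
    by (intro eventually_conj eventually_ge_at_top)
  then show ?thesis
  proof eventually_elim
    case (elim t)
    show ?case
    proof (intro allI impI)
      fix m assume m: "A m \<le> t"
      show "T m \<le> \<epsilon> * t"
      proof (cases "t0 + 1 \<le> A m")
        case True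
        have "T m \<le> (\<sigma> + \<eta>) * A m - (\<sigma> - \<eta>) * (A m - 1)"
          using jump[of m] near(1)[of "A m"] near(2)[of "A m - 1"] True by simp
        also have "\<dots> \<le> \<bar>\<sigma>\<bar> + 2 * \<eta> * A m" using \<open>0 < \<eta>\<close> by (simp add: algebra_simps)
        also have "\<dots> \<le> \<epsilon> * t / 2 + 2 * \<eta> * t"
          using elim m \<open>0 < \<epsilon>\<close> \<open>0 < \<eta>\<close> by (intro add_mono mult_left_mono) (auto simp: field_simps)
        also have "\<dots> = \<epsilon> * t" by (simp add: \<eta>_def)
        finally show ?thesis .
      next
        case False
        then have "T m \<le> \<bar>S (t0 + 1)\<bar>" using le[of m "t0 + 1"] by simp
        also have "\<dots> \<le> \<epsilon> * t" using elim \<open>0 < \<epsilon>\<close> by (simp add: field_simps)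
        finally show ?thesis .
      qed
    qed
  qed
qed

section \<open>Capping widths, and feasible widths from approximately feasible ones\<close>

context gpu_rental
begin

text \<open>If some width \<open>K\<close> has weighted duration at most \<open>e\<close>, capping
  there adds at most \<open>e\<close>. Otherwise every weighted duration exceeds \<open>e\<close>,
  so cost at most \<open>B\<close> forces k <= B / e, and a cap at that height changes
  nothing.\<close>

lemma truncation:
  assumes j: "j \<in> {1..epochs R i}" and "0 < e"
  obtains K where "kmin R i \<le> K"
    "\<And>k. kmin R i \<le> k \<Longrightarrow> load i j * (k / speed R i j k) \<le> B \<Longrightarrow>
      load i j * (1 / speed R i j (min k K)) \<le> load i j * (1 / speed R i j k) + e"
proof (cases "\<exists>K\<ge>kmin R i. load i j * (1 / speed R i j K) \<le> e")
  case True
  then obtain K where K: "kmin R i \<le> K" "load i j * (1 / speed R i j K) \<le> e" by blast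
  show thesis
  proof (rule that[OF K(1)])
    fix k assume k: "kmin R i \<le> k"
    have "0 \<le> load i j * (1 / speed R i j k)"
      using load_nonneg[OF j] speed_pos[OF j k] by simp
    then show "load i j * (1 / speed R i j (min k K)) \<le> load i j * (1 / speed R i j k) + e"
      using K(2) \<open>0 < e\<close> by (auto simp: min_def)
  qed
next
  case False
  show thesis
  proof (rule that[of "max (kmin R i) (B / e)"])
    fix k assume k: "kmin R i \<le> k" "load i j * (k / speed R i j k) \<le> B"
    have "0 < k" using k(1) kmin_pos by (metis less_le_trans)
    have "e < load i j * (1 / speed R i j k)" using False k(1) not_le by blast
    then have "e * k \<le> load i j * (1 / speed R i j k) * k"
      using \<open>0 < k\<close> by (intro mult_right_mono) simp_all
    also have "\<dots> \<le> B" using k(2) by (simp add: mult_ac)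
    finally have "k \<le> B / e" using \<open>0 < e\<close> by (simp add: field_simps)
    then show "load i j * (1 / speed R i j (min k (max (kmin R i) (B / e)))) \<le> load i j * (1 / speed R i j k) + e"
      using \<open>0 < e\<close> by (simp add: min_def max_def)
  qed simp
qed

text \<open>After capping, the approximants lie in one compact box, at the price of an arbitrarily
  small loss in the objective. There the larger of the two constraint violations attains its
  minimum, which the approximants force to be at most 0; the minimizer keeps the budget
  exactly.\<close>

lemma optimum_le_of_approximants:
  assumes opt: "\<And>y. y \<in> widths R \<Longrightarrow> width_budget R y \<le> b \<Longrightarrow> v \<le> width_jct R y"
    and approx: "\<And>\<delta>. 0 < \<delta> \<Longrightarrow> \<exists>y\<in>widths R. width_jct R y \<le> T + \<delta> \<and> width_budget R y \<le> b + \<delta>"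
  shows "v \<le> T"
proof (rule field_le_epsilon)
  fix \<epsilon> :: real assume "0 < \<epsilon>"
  define N where "N = (\<Sum>i\<in>UNIV. \<Sum>j = 1..epochs R i. 1 :: real)"
  have "0 \<le> N" unfolding N_def by (intro sum_nonneg) auto
  \<comment> \<open>There are \<open>N\<close> pairs of class and epoch, each losing at most
    \<open>e\<close>, so the loss in the objective is e N / \<open>total_rate R\<close>, below
    \<epsilon> / 2. The summand 1 avoids a case distinction on \<open>N\<close>.\<close>
  define e where "e = \<epsilon> * total_rate R / (2 * (N + 1))"
  have "0 < e" using \<open>0 < \<epsilon>\<close> total_rate_pos \<open>0 \<le> N\<close> by (simp add: e_def)
  define good where "good = (\<lambda>i j K. kmin R i \<le> K \<and> (\<forall>k. kmin R i \<le> k \<longrightarrow> load i j * (k / speed R i j k) \<le> b + 1 \<longrightarrow>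
      load i j * (1 / speed R i j (min k K)) \<le> load i j * (1 / speed R i j k) + e))"
  have ex: "\<exists>K. good i j K" if "j \<in> {1..epochs R i}" for i j
  proof -
    from that \<open>0 < e\<close> obtain K where "kmin R i \<le> K"
      "\<And>k. kmin R i \<le> k \<Longrightarrow> load i j * (k / speed R i j k) \<le> b + 1 \<Longrightarrow>
      load i j * (1 / speed R i j (min k K)) \<le> load i j * (1 / speed R i j k) + e"
      using truncation[of j i e "b + 1"] by blast
    then show ?thesis unfolding good_def by blast
  qed
  \<comment> \<open>Outside the actual epochs the interval from \<open>kmin\<close> to
    \<open>K\<close> is a single point, so all factors of the infinite product are compact and
    nonempty.\<close>
  define K where "K = (\<lambda>i j. if j \<in> {1..epochs R i} then SOME K. good i j K else kmin R i)"
  have good: "good i j (K i j)" if "j \<in> {1..epochs R i}" for i j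
    using someI_ex[OF ex[OF that]] that by (simp add: K_def)
  have K: "kmin R i \<le> K i j" for i j
    using good[of j i] by (cases "j \<in> {1..epochs R i}") (auto simp: good_def K_def)

  define Box where "Box = (\<Pi>\<^sub>E z\<in>UNIV. {kmin R (fst z)..K (fst z) (snd z)})"
  have "compactin (product_topology (\<lambda>_. euclidean) UNIV) Box"
    unfolding Box_def compactin_PiE by simp
  then have "compact Box" by (simp add: euclidean_product_topology)
  have curry_box: "curry z \<in> widths R" if "z \<in> Box" for z
    using that by (auto simp: Box_def widths_def PiE_iff)
  have cont: "continuous_on Box (\<lambda>z. speed R i j (z (i, j)))" if "j \<in> {1..epochs R i}" for i j
  proof (rule continuous_on_compose2[OF speed_continuous[OF that]])
    show "continuous_on Box (\<lambda>z. z (i, j))"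
      by (rule continuous_on_subset[OF continuous_on_product_coordinates]) simp
    show "(\<lambda>z. z (i, j)) ` Box \<subseteq> {kmin R i..}" by (auto simp: Box_def PiE_iff)
  qed
  have pos: "speed R i j (z (i, j)) \<noteq> 0" if "z \<in> Box" "j \<in> {1..epochs R i}" for z i j
  proof -
    have "kmin R i \<le> z (i, j)" using that(1) by (auto simp: Box_def PiE_iff)
    from speed_pos[OF that(2) this] show ?thesis by simp
  qed
  have coord: "continuous_on Box (\<lambda>z. z p)" for p
    by (rule continuous_on_subset[OF continuous_on_product_coordinates]) simp
  \<comment> \<open>Both constraints hold at a point exactly when \<open>H\<close> is at most 0
    there.\<close>
  define H where "H = (\<lambda>z. max (width_jct R (curry z) - (T + \<epsilon>)) (width_budget R (curry z) - b))"
  have "continuous_on Box H"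
    unfolding H_def width_jct_eq width_budget_eq curry_def
    using total_rate_pos by (intro continuous_intros cont coord) (auto simp: pos)
  moreover have "Box \<noteq> {}" using K by (auto simp: Box_def PiE_eq_empty_iff)
  ultimately obtain z0 where z0: "z0 \<in> Box" "\<And>z. z \<in> Box \<Longrightarrow> H z0 \<le> H z"
    using continuous_attains_inf[OF \<open>compact Box\<close>] by blast
  have "H z0 \<le> 0"
  proof (rule field_le_epsilon)
    fix \<delta> :: real assume "0 < \<delta>"
    \<comment> \<open>The bound 1 keeps every cost term below \<open>b + 1\<close>, as the caps
      presuppose; \<epsilon> / 2 leaves the other half of \<epsilon> to the loss from
      capping.\<close>
    define d where "d = Min {\<delta>, \<epsilon> / 2, 1}"
    have d: "0 < d" "d \<le> \<delta>" "d \<le> \<epsilon> / 2" "d \<le> 1" using \<open>0 < \<delta>\<close> \<open>0 < \<epsilon>\<close> by (auto simp: d_def)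
    obtain y where y: "y \<in> widths R" "width_jct R y \<le> T + d" "width_budget R y \<le> b + d"
      using approx[OF d(1)] by blast
    have ykmin: "kmin R i \<le> y i j" if "j \<in> {1..epochs R i}" for i j
      using y(1) that by (auto simp: widths_def)
    define z where "z = (\<lambda>(i, j). if j \<in> {1..epochs R i} then min (y i j) (K i j) else kmin R i)"
    have z: "z (i, j) = min (y i j) (K i j)" if "j \<in> {1..epochs R i}" for i j
      using that by (simp add: z_def)
    have "z \<in> Box"
      unfolding Box_def using K ykmin by (auto simp: z_def PiE_iff)
    have term_le: "load i j * (y i j / speed R i j (y i j)) \<le> b + 1" if j: "j \<in> {1..epochs R i}" for i j
    proof -
      have nn: "0 \<le> load i' j' * (y i' j' / speed R i' j' (y i' j'))" if "j' \<in> {1..epochs R i'}" for i' j'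
        using load_nonneg[OF that] speed_pos[OF that ykmin[OF that]] ykmin[OF that] kmin_pos[of i']
        by (intro mult_nonneg_nonneg divide_nonneg_nonneg) auto
      have "load i j * (y i j / speed R i j (y i j)) \<le> (\<Sum>j = 1..epochs R i. load i j * (y i j / speed R i j (y i j)))"
        by (rule member_le_sum) (use j nn in auto)
      also have "\<dots> \<le> width_budget R y"
        unfolding width_budget_eq
        by (rule member_le_sum[of i UNIV "\<lambda>i. \<Sum>j = 1..epochs R i. load i j * (y i j / speed R i j (y i j))"])
          (use nn in \<open>auto intro!: sum_nonneg\<close>)
      finally show ?thesis using y(3) d(4) by simp
    qed
    have "(\<Sum>i\<in>UNIV. \<Sum>j = 1..epochs R i. load i j * (1 / speed R i j (z (i, j)))) \<le>
        (\<Sum>i\<in>UNIV. \<Sum>j = 1..epochs R i. load i j * (1 / speed R i j (y i j)) + e)"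
      using good ykmin term_le by (intro sum_mono) (auto simp: good_def z)
    also have "\<dots> = (\<Sum>i\<in>UNIV. \<Sum>j = 1..epochs R i. load i j * (1 / speed R i j (y i j))) + e * N"
      by (simp add: sum.distrib N_def sum_distrib_left mult.commute)
    finally have "width_jct R (curry z) \<le> width_jct R y + e * N / total_rate R"
      unfolding width_jct_eq curry_conv add_divide_distrib[symmetric]
      using total_rate_pos by (intro divide_right_mono) simp_all
    also have "e * N / total_rate R = \<epsilon> / 2 * (N / (N + 1))"
      using total_rate_pos by (simp add: e_def)
    also have "\<dots> \<le> \<epsilon> / 2" using \<open>0 \<le> N\<close> \<open>0 < \<epsilon>\<close> by (intro mult_left_le) simp_all
    finally have F: "width_jct R (curry z) \<le> T + \<epsilon>" using y(2) d(3) by linarith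
    have "width_budget R (curry z) \<le> width_budget R y"
      unfolding width_budget_eq curry_conv
      using ykmin K by (intro load_sum_mono) (auto simp: z intro!: cost_mono)
    then have "H z \<le> \<delta>" using F y(3) d \<open>0 < \<delta>\<close> by (simp add: H_def)
    then show "H z0 \<le> 0 + \<delta>" using z0(2)[OF \<open>z \<in> Box\<close>] by simp
  qed
  then have "width_jct R (curry z0) \<le> T + \<epsilon>" "width_budget R (curry z0) \<le> b"
    by (simp_all add: H_def)
  then show "v \<le> T + \<epsilon>" using opt[OF curry_box[OF z0(1)]] by simp
qed

text \<open>One null set is discarded for all classes and epochs at once; on the remaining paths the
  arguments are deterministic.\<close>

definition regular :: "'w \<Rightarrow> bool" where
  "regular w \<longleftrightarrow> w \<in> space (sample R) \<and>
    (\<forall>i. ((\<lambda>t. real (card (arrived_class R w i t)) / t) \<longlongrightarrow> rate R i) at_top) \<and>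
    (\<forall>i. \<forall>j\<in>{1..epochs R i}.
      ((\<lambda>t. (\<Sum>m\<in>arrived_class R w i t. work R m j w) / real (card (arrived_class R w i t)))
         \<longlongrightarrow> mean_work R i j) at_top)"

lemma AE_regular: "AE w in sample R. regular w"
proof -
  have "AE w in sample R. \<forall>i. ((\<lambda>t. real (card (arrived_class R w i t)) / t) \<longlongrightarrow> rate R i) at_top"
    using arrival_average by (simp add: AE_all_countable)
  moreover have "AE w in sample R. \<forall>i\<in>UNIV. \<forall>j\<in>{1..epochs R i}.
      ((\<lambda>t. (\<Sum>m\<in>arrived_class R w i t. work R m j w) / real (card (arrived_class R w i t)))
         \<longlongrightarrow> mean_work R i j) at_top"
    by (intro AE_finite_allI work_average) auto
  ultimately show ?thesis unfolding regular_def using AE_space by eventually_elim auto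
qed

lemma finite_arrived_class: "w \<in> space (sample R) \<Longrightarrow> finite (arrived_class R w i t)"
  unfolding arrived_class_def using arrived_finite by simp

lemma sum_arrived:
  assumes "w \<in> space (sample R)"
  shows "(\<Sum>m\<in>arrived R w t. f m) = (\<Sum>i\<in>UNIV. \<Sum>m\<in>arrived_class R w i t. f m)"
  unfolding arrived_class_def
  by (rule sum.group[symmetric]) (use arrived_finite[OF assms] in auto)

lemma regular_class_work:
  assumes "regular w" "j \<in> {1..epochs R i}"
  shows "((\<lambda>t. (\<Sum>m\<in>arrived_class R w i t. work R m j w) / t) \<longlongrightarrow> load i j) at_top"
proof -
  have "((\<lambda>t. real (card (arrived_class R w i t)) / t *
      ((\<Sum>m\<in>arrived_class R w i t. work R m j w) / real (card (arrived_class R w i t)))) \<longlongrightarrow> load i j) at_top"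
    unfolding load_def using assms by (intro tendsto_mult) (auto simp: regular_def)
  moreover have "real (card (arrived_class R w i t)) / t *
      ((\<Sum>m\<in>arrived_class R w i t. work R m j w) / real (card (arrived_class R w i t))) =
      (\<Sum>m\<in>arrived_class R w i t. work R m j w) / t" for t
    using finite_arrived_class[of w i t] assms(1)
    \<comment> \<open>With no arrivals of the class both sides are 0, as division by 0 gives
      0.\<close>
    by (cases "card (arrived_class R w i t) = 0") (auto simp: regular_def)
  ultimately show ?thesis by simp
qed

lemma regular_count:
  assumes "regular w"
  shows "((\<lambda>t. real (card (arrived R w t)) / t) \<longlongrightarrow> total_rate R) at_top"
proof -
  have w: "w \<in> space (sample R)" using assms by (simp add: regular_def)
  have "((\<lambda>t. \<Sum>i\<in>UNIV. real (card (arrived_class R w i t)) / t) \<longlongrightarrow> total_rate R) at_top"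
    unfolding total_rate_def using assms by (intro tendsto_sum) (auto simp: regular_def)
  moreover have "real (card (arrived R w t)) = (\<Sum>i\<in>UNIV. real (card (arrived_class R w i t)))" for t
    using sum_arrived[OF w, of "\<lambda>_. 1 :: real" t] by simp
  ultimately show ?thesis by (simp add: sum_divide_distrib)
qed

text \<open>With \<open>a\<close> = 1 / speed the summands are the JCTs under fixed widths, with
  \<open>a\<close> = width / speed the GPU times of the jobs.\<close>

lemma regular_average:
  assumes "regular w"
  shows "((\<lambda>t. (\<Sum>m\<in>arrived R w t. \<Sum>j = 1..epochs R (jclass R m w).
      a (jclass R m w) j * work R m j w) / t) \<longlongrightarrow>
    (\<Sum>i\<in>UNIV. \<Sum>j = 1..epochs R i. load i j * a i j)) at_top"
proof -
  have w: "w \<in> space (sample R)" using assms by (simp add: regular_def)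
  have "(\<Sum>m\<in>arrived_class R w i t. \<Sum>j = 1..epochs R (jclass R m w).
        a (jclass R m w) j * work R m j w) / t =
      (\<Sum>j = 1..epochs R i. (\<Sum>m\<in>arrived_class R w i t. work R m j w) / t * a i j)" for i t
  proof -
    have "(\<Sum>m\<in>arrived_class R w i t. \<Sum>j = 1..epochs R (jclass R m w). a (jclass R m w) j * work R m j w) =
      (\<Sum>m\<in>arrived_class R w i t. \<Sum>j = 1..epochs R i. a i j * work R m j w)"
      by (rule sum.cong) (auto simp: arrived_class_def)
    also have "\<dots> = (\<Sum>j = 1..epochs R i. a i j * (\<Sum>m\<in>arrived_class R w i t. work R m j w))"
      unfolding sum_distrib_left by (rule sum.swap)
    finally have E: "(\<Sum>m\<in>arrived_class R w i t. \<Sum>j = 1..epochs R (jclass R m w).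
        a (jclass R m w) j * work R m j w) =
      (\<Sum>j = 1..epochs R i. a i j * (\<Sum>m\<in>arrived_class R w i t. work R m j w))" .
    show ?thesis
      unfolding E sum_divide_distrib[of _ "{1..epochs R i}"] by (rule sum.cong) (simp_all add: mult.commute)
  qed
  then have "(\<Sum>m\<in>arrived R w t. \<Sum>j = 1..epochs R (jclass R m w). a (jclass R m w) j * work R m j w) / t =
    (\<Sum>i\<in>UNIV. \<Sum>j = 1..epochs R i. (\<Sum>m\<in>arrived_class R w i t. work R m j w) / t * a i j)" for t
    unfolding sum_arrived[OF w] sum_divide_distrib[of _ UNIV] by (rule sum.cong[OF refl])
  moreover have "((\<lambda>t. \<Sum>i\<in>UNIV. \<Sum>j = 1..epochs R i.
      (\<Sum>m\<in>arrived_class R w i t. work R m j w) / t * a i j) \<longlongrightarrow>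
    (\<Sum>i\<in>UNIV. \<Sum>j = 1..epochs R i. load i j * a i j)) at_top"
    by (intro tendsto_sum tendsto_mult_right regular_class_work assms)
  ultimately show ?thesis by simp
qed

end

section \<open>Sample paths of arbitrary policies\<close>

lemma nn_integral_interval_split:
  fixes f :: "real \<Rightarrow> ennreal"
  assumes [measurable]: "f \<in> borel_measurable borel" and "a \<le> b" "b \<le> c"
  shows "(\<integral>\<^sup>+u\<in>{a..<b}. f u \<partial>lborel) + (\<integral>\<^sup>+u\<in>{b..<c}. f u \<partial>lborel) = (\<integral>\<^sup>+u\<in>{a..<c}. f u \<partial>lborel)"
proof -
  have "(\<integral>\<^sup>+u\<in>{a..<b}. f u \<partial>lborel) + (\<integral>\<^sup>+u\<in>{b..<c}. f u \<partial>lborel) =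
      (\<integral>\<^sup>+u. f u * indicator {a..<b} u + f u * indicator {b..<c} u \<partial>lborel)"
    by (rule nn_integral_add[symmetric]) simp_all
  also have "\<dots> = (\<integral>\<^sup>+u\<in>{a..<c}. f u \<partial>lborel)"
    by (rule nn_integral_cong) (use assms in \<open>auto split: split_indicator\<close>)
  finally show ?thesis .
qed

lemma nn_integral_intervals_sum:
  fixes f :: "real \<Rightarrow> ennreal" and e :: "nat \<Rightarrow> real"
  assumes "f \<in> borel_measurable borel" and "\<And>j. j < n \<Longrightarrow> e j \<le> e (Suc j)"
  shows "(\<Sum>j = 1..n. \<integral>\<^sup>+u\<in>{e (j - 1)..<e j}. f u \<partial>lborel) = (\<integral>\<^sup>+u\<in>{e 0..<e n}. f u \<partial>lborel) \<and> e 0 \<le> e n"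
  using assms(2)
proof (induction n)
  case (Suc n)
  then have *: "(\<Sum>j = 1..n. \<integral>\<^sup>+u\<in>{e (j - 1)..<e j}. f u \<partial>lborel) = (\<integral>\<^sup>+u\<in>{e 0..<e n}. f u \<partial>lborel)"
    "e 0 \<le> e n" "e n \<le> e (Suc n)" by auto
  then show ?case
    using nn_integral_interval_split[OF assms(1) *(2,3)] by simp
qed simp

lemma nn_integral_Icc_eq_Ico:
  fixes f :: "real \<Rightarrow> ennreal"
  shows "(\<integral>\<^sup>+u\<in>{a..b}. f u \<partial>lborel) = (\<integral>\<^sup>+u\<in>{a..<b}. f u \<partial>lborel)"
  by (rule nn_integral_cong_AE, rule AE_mp[OF AE_lborel_singleton[of b]]) (auto split: split_indicator)

lemma le_enn2real: "ennreal x \<le> y \<Longrightarrow> y < \<infinity> \<Longrightarrow> x \<le> enn2real y"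
  using enn2real_mono[of "ennreal x" y] by (cases "0 \<le> x") (auto intro: order_trans[OF _ enn2real_nonneg])

section \<open>Epoch ends along a sample path\<close>

lemma epoch_end_Suc_mono: "epoch_end R p w m j \<le> epoch_end R p w m (Suc j)"
  by (auto intro!: Inf_greatest)

lemma epoch_end_mono: "i \<le> j \<Longrightarrow> epoch_end R p w m i \<le> epoch_end R p w m j"
  by (rule lift_Suc_mono_le[of "epoch_end R p w m"]) (rule epoch_end_Suc_mono)

lemma epoch_end_ge_arrival: "ereal (arrival R m w) \<le> epoch_end R p w m j"
  using epoch_end_mono[of 0 j R p w m] by simp

lemma epoch_end_Suc_eq:
  assumes "epoch_end R p w m j = ereal e"
  shows "epoch_end R p w m (Suc j) = Inf {ereal t | t. e \<le> t \<and> ennreal (work R m (Suc j) w) \<le>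
    (\<integral>\<^sup>+u\<in>{e..t}. ennreal (proc_rate R (jclass R m w) (Suc j) (alloc p w m u)) \<partial>lborel)}"
proof -
  have "{u. ereal e \<le> ereal u \<and> u \<le> t} = {e..t}" for t by auto
  then show ?thesis by (simp add: assms)
qed

text \<open>The infimum defining the end of the epoch is attained: the work processed is a measure
  with the processing rate as density, finite on the interval up to \<open>E + 1\<close>, hence
  continuous along the intervals that shrink to the one ending at \<open>E\<close>.\<close>

lemma epoch_end_attained:
  assumes e: "epoch_end R p w m j = ereal e" and E: "epoch_end R p w m (Suc j) = ereal E"
    and meas: "(\<lambda>u. proc_rate R (jclass R m w) (Suc j) (alloc p w m u)) \<in> borel_measurable borel"
    and fin: "(\<integral>\<^sup>+u\<in>{e..E + 1}. ennreal (proc_rate R (jclass R m w) (Suc j) (alloc p w m u)) \<partial>lborel) < \<infinity>"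
  shows "ennreal (work R m (Suc j) w) \<le>
    (\<integral>\<^sup>+u\<in>{e..E}. ennreal (proc_rate R (jclass R m w) (Suc j) (alloc p w m u)) \<partial>lborel)"
proof -
  define r where "r = (\<lambda>u. ennreal (proc_rate R (jclass R m w) (Suc j) (alloc p w m u)))"
  define \<nu> where "\<nu> = density lborel r"
  have [measurable]: "r \<in> borel_measurable borel" using meas by (simp add: r_def)
  have \<nu>: "emeasure \<nu> A = (\<integral>\<^sup>+u\<in>A. r u \<partial>lborel)" if "A \<in> sets borel" for A
    using that by (simp add: \<nu>_def emeasure_density)
  define A where "A = (\<lambda>n. {e..E + 1 / real (Suc n)})"
  have dec: "decseq A"
    by (rule decseq_SucI) (auto simp: A_def field_simps intro: order_trans)
  have A0: "A n \<subseteq> {e..E + 1}" for n by (auto simp: A_def field_simps intro: order_trans)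
  have "emeasure \<nu> (A n) \<noteq> \<infinity>" for n
  proof -
    have "emeasure \<nu> (A n) \<le> emeasure \<nu> {e..E + 1}"
      by (rule emeasure_mono[OF A0]) (simp add: \<nu>_def)
    also have "\<dots> < \<infinity>" using fin by (simp add: \<nu> r_def)
    finally show ?thesis by simp
  qed
  then have "(INF n. emeasure \<nu> (A n)) = emeasure \<nu> (\<Inter>n. A n)"
    by (intro INF_emeasure_decseq dec) (auto simp: A_def \<nu>_def)
  moreover have "(\<Inter>n. A n) = {e..E}"
  proof (intro equalityI subsetI)
    fix u assume u: "u \<in> (\<Inter>n. A n)"
    have "u \<le> E"
    proof (rule field_le_epsilon)
      fix \<epsilon> :: real assume "0 < \<epsilon>"
      then obtain n where "1 / real (Suc n) < \<epsilon>" using nat_approx_posE by blast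
      moreover have "u \<le> E + 1 / real (Suc n)" using u by (auto simp: A_def)
      ultimately show "u \<le> E + \<epsilon>" by simp
    qed
    then show "u \<in> {e..E}" using u by (auto simp: A_def)
  next
    fix u assume u: "u \<in> {e..E}"
    have "E \<le> E + 1 / real (Suc n)" for n by simp
    with u show "u \<in> (\<Inter>n. A n)" unfolding A_def by (fastforce intro: order_trans)
  qed
  moreover have "ennreal (work R m (Suc j) w) \<le> emeasure \<nu> (A n)" for n
  proof -
    have "Inf {ereal t | t. e \<le> t \<and> ennreal (work R m (Suc j) w) \<le> (\<integral>\<^sup>+u\<in>{e..t}. r u \<partial>lborel)} <
        ereal (E + 1 / real (Suc n))"
      using E unfolding epoch_end_Suc_eq[OF e] r_def by simp
    then obtain t where t: "t < E + 1 / real (Suc n)" "ennreal (work R m (Suc j) w) \<le> (\<integral>\<^sup>+u\<in>{e..t}. r u \<partial>lborel)"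
      by (auto simp: Inf_less_iff)
    note t(2)
    also have "(\<integral>\<^sup>+u\<in>{e..t}. r u \<partial>lborel) = emeasure \<nu> {e..t}" by (simp add: \<nu>)
    also have "\<dots> \<le> emeasure \<nu> (A n)"
      by (rule emeasure_mono) (use t(1) in \<open>auto simp: A_def \<nu>_def\<close>)
    finally show ?thesis .
  qed
  ultimately have "ennreal (work R m (Suc j) w) \<le> emeasure \<nu> {e..E}"
    by (metis INF_greatest)
  then show ?thesis by (simp add: \<nu> r_def)
qed

context gpu_rental
begin

lemma proc_rate_mono:
  assumes "j \<in> {1..epochs R i}" "k \<le> k'"
  shows "proc_rate R i j k \<le> proc_rate R i j k'"
  using assms speed_mono[OF assms(1)] speed_pos[OF assms(1), of k']
  by (auto simp: proc_rate_def mono_on_def)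

text \<open>\<open>speed\<close> is unrestricted below \<open>kmin\<close>; cut off to 0 there it is
  monotone on the whole line, hence Borel.\<close>

lemma proc_rate_measurable [measurable]:
  "j \<in> {1..epochs R i} \<Longrightarrow> proc_rate R i j \<in> borel_measurable borel"
  by (rule borel_measurable_mono) (auto intro!: monoI proc_rate_mono)

text \<open>Below \<open>kmin\<close> the rate is 0, and the signs of \<open>c\<close> and
  \<open>d\<close> keep the majorant nonnegative.\<close>

lemma proc_rate_le_affine:
  assumes "0 \<le> c" "0 \<le> d" "\<And>x. kmin R i \<le> x \<Longrightarrow> speed R i j x \<le> d + c * x" "0 \<le> x"
  shows "proc_rate R i j x \<le> d + c * x"
  using assms by (auto simp: proc_rate_def)

lemma
  assumes p: "policy R p" and w: "w \<in> space (sample R)"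
  shows alloc_measurable: "alloc p w m \<in> borel_measurable borel"
    and alloc_nonneg: "0 \<le> alloc p w m t"
    and alloc_before_arrival: "m \<notin> arrived R w t \<Longrightarrow> alloc p w m t = 0"
    and rented_measurable: "rented p w \<in> borel_measurable borel"
    and sum_alloc_le_rented: "finite J \<Longrightarrow> (\<Sum>m\<in>J. alloc p w m t) \<le> rented p w t"
proof -
  show "alloc p w m \<in> borel_measurable borel" "rented p w \<in> borel_measurable borel"
    using p w by (auto simp: policy_def)
  have nonneg: "0 \<le> alloc p w m t" for m t
  proof -
    have "alloc p w m t = 0 \<or> kmin R (jclass R m w) \<le> alloc p w m t"
      using p w unfolding policy_def by blast
    then show ?thesis using kmin_pos[of "jclass R m w"] by auto
  qed
  then show "0 \<le> alloc p w m t" .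
  have zero: "alloc p w m t = 0" if "m \<notin> arrived R w t" for m t
    using p w that unfolding policy_def arrived_def by blast
  then show "alloc p w m t = 0" if "m \<notin> arrived R w t" using that .
  assume J: "finite J"
  have "(\<Sum>m\<in>J. alloc p w m t) = (\<Sum>m\<in>J \<inter> arrived R w t. alloc p w m t)"
    by (rule sum.mono_neutral_right) (use J zero in auto)
  also have "\<dots> \<le> (\<Sum>m\<in>arrived R w t. alloc p w m t)"
    by (rule sum_mono2) (use arrived_finite[OF w] nonneg in auto)
  also have "\<dots> \<le> rented p w t" using p w by (simp add: policy_def)
  finally show "(\<Sum>m\<in>J. alloc p w m t) \<le> rented p w t" .
qed

lemma completed_epochs:
  assumes "completion R p w m = ereal (arrival R m w + D)"
  obtains e where "e 0 = arrival R m w" "e (epochs R (jclass R m w)) = arrival R m w + D"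
    "\<And>j. e j \<le> e (Suc j)"
    "\<And>j. j \<le> epochs R (jclass R m w) \<Longrightarrow> epoch_end R p w m j = ereal (e j)"
proof -
  let ?n = "epochs R (jclass R m w)"
  \<comment> \<open>Stopping the index at the last epoch makes \<open>e\<close> constant afterwards,
    so it is monotone for all indices even though later values of \<open>epoch_end\<close> need not
    be finite.\<close>
  define e where "e = (\<lambda>j. real_of_ereal (epoch_end R p w m (min j ?n)))"
  have *: "epoch_end R p w m j = ereal (e j)" if "j \<le> ?n" for j
  proof -
    have "epoch_end R p w m j \<le> ereal (arrival R m w + D)"
      using epoch_end_mono[OF that, of R p w m] assms by (simp add: completion_def)
    with epoch_end_ge_arrival[of R m w p j] show ?thesis
      using that by (cases "epoch_end R p w m j") (auto simp: e_def)
  qed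
  show thesis
  proof (rule that[of e])
    show "e 0 = arrival R m w" by (simp add: e_def)
    show "e ?n = arrival R m w + D" using *[of ?n] assms by (simp add: completion_def)
    show "e j \<le> e (Suc j)" for j
    proof (cases "Suc j \<le> ?n")
      case True
      then show ?thesis using epoch_end_Suc_mono[of R p w m j] *[of j] *[of "Suc j"] by simp
    next
      case False
      then have "min j ?n = ?n" "min (Suc j) ?n = ?n" by auto
      then show ?thesis by (simp add: e_def)
    qed
  qed (rule *)
qed

text \<open>The affine majorant is integrated over the time spent in the epoch. Finite rental up to
  every time bounds the GPU time of the job, which gives the finiteness that
  \<open>epoch_end_attained\<close> asks for and allows the passage to real numbers.\<close>

lemma epoch_work_le:
  assumes p: "policy R p" and w: "w \<in> space (sample R)"
    and fin: "\<And>t. (\<integral>\<^sup>+u\<in>{0..t}. ennreal (rented p w u) \<partial>lborel) < \<infinity>"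
    and j: "Suc j \<in> {1..epochs R (jclass R m w)}"
    and e: "epoch_end R p w m j = ereal e" and E: "epoch_end R p w m (Suc j) = ereal E"
    and cd: "0 \<le> c" "0 \<le> d" "\<And>x. kmin R (jclass R m w) \<le> x \<Longrightarrow> speed R (jclass R m w) (Suc j) x \<le> d + c * x"
  shows "work R m (Suc j) w \<le> d * (E - e) + c * enn2real (\<integral>\<^sup>+u\<in>{e..<E}. ennreal (alloc p w m u) \<partial>lborel)"
proof -
  let ?r = "\<lambda>u. proc_rate R (jclass R m w) (Suc j) (alloc p w m u)"
  note [measurable] = alloc_measurable[OF p w, of m] rented_measurable[OF p w] proc_rate_measurable[OF j]
  have "e \<le> E" using epoch_end_Suc_mono[of R p w m j] e E by simp
  have "0 \<le> e" using epoch_end_ge_arrival[of R m w p j] e arrival_nonneg[OF w, of m] by simp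
  have alloc_fin: "(\<integral>\<^sup>+u\<in>{e..t}. ennreal (alloc p w m u) \<partial>lborel) < \<infinity>" for t
  proof -
    have "(\<integral>\<^sup>+u\<in>{e..t}. ennreal (alloc p w m u) \<partial>lborel) \<le> (\<integral>\<^sup>+u\<in>{0..t}. ennreal (rented p w u) \<partial>lborel)"
      using \<open>0 \<le> e\<close> sum_alloc_le_rented[OF p w, of "{m}"]
      by (intro nn_integral_mono) (auto split: split_indicator intro!: ennreal_leI)
    then show ?thesis using fin[of t] by (rule le_less_trans)
  qed
  have rate_le: "(\<integral>\<^sup>+u\<in>{e..t}. ennreal (?r u) \<partial>lborel) \<le>
      ennreal (d * (t - e)) + ennreal c * (\<integral>\<^sup>+u\<in>{e..t}. ennreal (alloc p w m u) \<partial>lborel)" if "e \<le> t" for t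
  proof -
    have "(\<integral>\<^sup>+u\<in>{e..t}. ennreal (?r u) \<partial>lborel) \<le>
        (\<integral>\<^sup>+u. ennreal d * indicator {e..t} u + ennreal c * (ennreal (alloc p w m u) * indicator {e..t} u) \<partial>lborel)"
    proof (rule nn_integral_mono)
      fix u
      have "ennreal (?r u) \<le> ennreal (d + c * alloc p w m u)"
        by (intro ennreal_leI proc_rate_le_affine cd alloc_nonneg[OF p w])
      also have "\<dots> = ennreal d + ennreal c * ennreal (alloc p w m u)"
        using cd alloc_nonneg[OF p w] by (simp add: ennreal_plus ennreal_mult)
      finally show "ennreal (?r u) * indicator {e..t} u \<le>
          ennreal d * indicator {e..t} u + ennreal c * (ennreal (alloc p w m u) * indicator {e..t} u)"
        by (auto split: split_indicator)
    qed
    also have "\<dots> = ennreal d * ennreal (t - e) + ennreal c * (\<integral>\<^sup>+u\<in>{e..t}. ennreal (alloc p w m u) \<partial>lborel)"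
      using that by (simp add: nn_integral_add nn_integral_cmult)
    finally show ?thesis using cd that by (simp add: ennreal_mult)
  qed
  have "ennreal (work R m (Suc j) w) \<le> (\<integral>\<^sup>+u\<in>{e..E}. ennreal (?r u) \<partial>lborel)"
  proof (rule epoch_end_attained[OF e E])
    have "ennreal c * (\<integral>\<^sup>+u\<in>{e..E + 1}. ennreal (alloc p w m u) \<partial>lborel) < \<infinity>"
      using alloc_fin by (simp add: ennreal_mult_less_top)
    then show "(\<integral>\<^sup>+u\<in>{e..E + 1}. ennreal (?r u) \<partial>lborel) < \<infinity>"
      using rate_le[of "E + 1"] \<open>e \<le> E\<close> by (auto intro: le_less_trans)
  qed measurable
  also have "\<dots> \<le> ennreal (d * (E - e)) + ennreal c * (\<integral>\<^sup>+u\<in>{e..<E}. ennreal (alloc p w m u) \<partial>lborel)"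
    using rate_le[OF \<open>e \<le> E\<close>] by (simp add: nn_integral_Icc_eq_Ico)
  also have "(\<integral>\<^sup>+u\<in>{e..<E}. ennreal (alloc p w m u) \<partial>lborel) =
      ennreal (enn2real (\<integral>\<^sup>+u\<in>{e..<E}. ennreal (alloc p w m u) \<partial>lborel))"
    using alloc_fin[of E] by (simp add: nn_integral_Icc_eq_Ico)
  also have "ennreal (d * (E - e)) + ennreal c * \<dots> =
      ennreal (d * (E - e) + c * enn2real (\<integral>\<^sup>+u\<in>{e..<E}. ennreal (alloc p w m u) \<partial>lborel))"
    using cd \<open>e \<le> E\<close> by (simp add: ennreal_plus ennreal_mult)
  finally show ?thesis using cd \<open>e \<le> E\<close> by (subst (asm) ennreal_le_iff) auto
qed

text \<open>The widths pool, for each class and epoch, the durations and GPU times of all jobs in \<open>J\<close>.\<close>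

lemma completed_jobs_widths:
  assumes p: "policy R p" and w: "w \<in> space (sample R)"
    and fin: "\<And>t. (\<integral>\<^sup>+u\<in>{0..t}. ennreal (rented p w u) \<partial>lborel) < \<infinity>"
    and J: "finite J"
    and compl: "\<And>m. m \<in> J \<Longrightarrow> completion R p w m = ereal (arrival R m w + D m)"
      "\<And>m. m \<in> J \<Longrightarrow> arrival R m w + D m \<le> t"
  defines "X \<equiv> \<lambda>i j. \<Sum>m | m \<in> J \<and> jclass R m w = i. work R m j w"
  obtains y where "y \<in> widths R"
    "(\<Sum>i\<in>UNIV. \<Sum>j = 1..epochs R i. X i j / speed R i j (y i j)) \<le> (\<Sum>m\<in>J. D m)"
    "(\<Sum>i\<in>UNIV. \<Sum>j = 1..epochs R i. y i j * (X i j / speed R i j (y i j))) \<le>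
      enn2real (\<integral>\<^sup>+u\<in>{0..t}. ennreal (rented p w u) \<partial>lborel)"
proof -
  let ?n = "\<lambda>m. epochs R (jclass R m w)"
  have "\<forall>m. \<exists>e. m \<in> J \<longrightarrow> e 0 = arrival R m w \<and> e (?n m) = arrival R m w + D m \<and>
      (\<forall>j. e j \<le> e (Suc j)) \<and> (\<forall>j\<le>?n m. epoch_end R p w m j = ereal (e j))" (is "\<forall>m. \<exists>e. ?P m e")
  proof
    fix m
    show "\<exists>e. ?P m e"
    proof (cases "m \<in> J")
      case True
      then obtain e where "e 0 = arrival R m w" "e (?n m) = arrival R m w + D m" "\<And>j. e j \<le> e (Suc j)"
        "\<And>j. j \<le> ?n m \<Longrightarrow> epoch_end R p w m j = ereal (e j)"
        using completed_epochs[OF compl(1)] by blast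
      then show ?thesis by blast
    qed simp
  qed
  from choice[OF this] obtain e where e': "\<forall>m. m \<in> J \<longrightarrow> e m 0 = arrival R m w \<and> e m (?n m) = arrival R m w + D m \<and>
      (\<forall>j. e m j \<le> e m (Suc j)) \<and> (\<forall>j\<le>?n m. epoch_end R p w m j = ereal (e m j))" ..
  have e: "e m 0 = arrival R m w" "e m (?n m) = arrival R m w + D m"
      "\<And>j. e m j \<le> e m (Suc j)" "\<And>j. j \<le> ?n m \<Longrightarrow> epoch_end R p w m j = ereal (e m j)"
    if "m \<in> J" for m
    using e' that by auto
  define g where "g = (\<lambda>m j. enn2real (\<integral>\<^sup>+u\<in>{e m (j - 1)..<e m j}. ennreal (alloc p w m u) \<partial>lborel))"
  have g_fin: "(\<integral>\<^sup>+u\<in>{e m (j - 1)..<e m j}. ennreal (alloc p w m u) \<partial>lborel) < \<infinity>"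
    if "m \<in> J" "j \<in> {1..?n m}" for m j
  proof -
    have "ereal (arrival R m w) \<le> ereal (e m (j - 1))"
      using e(4)[OF that(1), of "j - 1"] that(2) epoch_end_ge_arrival[of R m w p "j - 1"] by auto
    then have "0 \<le> e m (j - 1)" using arrival_nonneg[OF w, of m] by simp
    then have "(\<integral>\<^sup>+u\<in>{e m (j - 1)..<e m j}. ennreal (alloc p w m u) \<partial>lborel) \<le>
        (\<integral>\<^sup>+u\<in>{0..e m j}. ennreal (rented p w u) \<partial>lborel)"
      using sum_alloc_le_rented[OF p w, of "{m}"]
      by (intro nn_integral_mono) (auto split: split_indicator intro!: ennreal_leI)
    then show ?thesis using fin by (rule le_less_trans)
  qed
  define dur where "dur = (\<lambda>i j. \<Sum>m | m \<in> J \<and> jclass R m w = i. e m j - e m (j - 1))"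
  define G where "G = (\<lambda>i j. \<Sum>m | m \<in> J \<and> jclass R m w = i. g m j)"
  have dur_nonneg: "0 \<le> e m j - e m (j - 1)" if "m \<in> J" for m j
    using e(3)[OF that, of "j - 1"] by (cases j) auto
  have ex: "\<exists>k. kmin R i \<le> k \<and> X i j / speed R i j k \<le> dur i j \<and> k * (X i j / speed R i j k) \<le> G i j"
    if j: "j \<in> {1..epochs R i}" for i j
  proof -
    show ?thesis
    proof (rule pooled_width[OF j, of "dur i j" "G i j" "X i j"])
      show "0 \<le> dur i j" unfolding dur_def by (intro sum_nonneg dur_nonneg) simp
      show "0 \<le> G i j" unfolding G_def by (intro sum_nonneg) (auto simp: g_def)
      \<comment> \<open>Total duration 0 makes every single duration 0, so each GPU time is an
        integral over an empty interval.\<close>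
      show "G i j = 0" if "dur i j = 0"
      proof -
        have "\<forall>m\<in>{m. m \<in> J \<and> jclass R m w = i}. e m j - e m (j - 1) = 0"
          using that J dur_nonneg unfolding dur_def by (subst (asm) sum_nonneg_eq_0_iff) auto
        then have "g m j = 0" if "m \<in> J" "jclass R m w = i" for m
          using that by (auto simp: g_def)
        then show ?thesis by (auto simp: G_def)
      qed
      fix c d assume cd: "0 \<le> c" "0 \<le> d" "\<And>x. kmin R i \<le> x \<Longrightarrow> speed R i j x \<le> d + c * x"
      have "work R m j w \<le> d * (e m j - e m (j - 1)) + c * g m j" if m: "m \<in> J" "jclass R m w = i" for m
      proof -
        have "Suc (j - 1) = j" using j by auto
        then show ?thesis
          using epoch_work_le[OF p w fin, of "j - 1" m "e m (j - 1)" "e m j" c d] e(4)[OF m(1), of "j - 1"]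
            e(4)[OF m(1), of j] j m cd by (auto simp: g_def)
      qed
      then have "X i j \<le> (\<Sum>m | m \<in> J \<and> jclass R m w = i. d * (e m j - e m (j - 1)) + c * g m j)"
        unfolding X_def by (intro sum_mono) auto
      then show "X i j \<le> d * dur i j + c * G i j"
        by (simp add: sum.distrib sum_distrib_left dur_def G_def)
    qed blast
  qed
  define y where "y = (\<lambda>i j. SOME k. kmin R i \<le> k \<and> X i j / speed R i j k \<le> dur i j \<and>
    k * (X i j / speed R i j k) \<le> G i j)"
  have y': "kmin R i \<le> y i j \<and> X i j / speed R i j (y i j) \<le> dur i j \<and>
      y i j * (X i j / speed R i j (y i j)) \<le> G i j" if "j \<in> {1..epochs R i}" for i j
    unfolding y_def by (rule someI_ex[OF ex[OF that]])
  have regroup: "(\<Sum>i\<in>UNIV. \<Sum>j = 1..epochs R i. \<Sum>m | m \<in> J \<and> jclass R m w = i. f m j) =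
      (\<Sum>m\<in>J. \<Sum>j = 1..?n m. f m j)" for f :: "nat \<Rightarrow> nat \<Rightarrow> real"
  proof -
    have "(\<Sum>j = 1..epochs R i. \<Sum>m | m \<in> J \<and> jclass R m w = i. f m j) =
        (\<Sum>m | m \<in> J \<and> jclass R m w = i. \<Sum>j = 1..?n m. f m j)" for i
      by (subst sum.swap) (auto intro!: sum.cong)
    then show ?thesis using sum.group[of J UNIV "\<lambda>m. jclass R m w" "\<lambda>m. \<Sum>j = 1..?n m. f m j"] J by simp
  qed
  show thesis
  proof (rule that[of y])
    show "y \<in> widths R" using y' by (simp add: widths_def)
    have "(\<Sum>i\<in>UNIV. \<Sum>j = 1..epochs R i. X i j / speed R i j (y i j)) \<le>
        (\<Sum>i\<in>UNIV. \<Sum>j = 1..epochs R i. dur i j)"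
      using y' by (intro sum_mono) blast
    also have "\<dots> = (\<Sum>m\<in>J. \<Sum>j = 1..?n m. e m j - e m (j - 1))" unfolding dur_def by (rule regroup)
    also have "\<dots> = (\<Sum>m\<in>J. D m)"
    proof (rule sum.cong[OF refl])
      fix m assume m: "m \<in> J"
      have "(\<Sum>j = 1..n. e m j - e m (j - 1)) = e m n - e m 0" for n by (induction n) auto
      then show "(\<Sum>j = 1..?n m. e m j - e m (j - 1)) = D m" using e(1,2)[OF m] by simp
    qed
    finally show "(\<Sum>i\<in>UNIV. \<Sum>j = 1..epochs R i. X i j / speed R i j (y i j)) \<le> (\<Sum>m\<in>J. D m)" .
    have "(\<Sum>i\<in>UNIV. \<Sum>j = 1..epochs R i. y i j * (X i j / speed R i j (y i j))) \<le>
        (\<Sum>i\<in>UNIV. \<Sum>j = 1..epochs R i. G i j)"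
      using y' by (intro sum_mono) blast
    also have "\<dots> = (\<Sum>m\<in>J. \<Sum>j = 1..?n m. g m j)" unfolding G_def by (rule regroup)
    also have "\<dots> \<le> enn2real (\<integral>\<^sup>+u\<in>{0..t}. ennreal (rented p w u) \<partial>lborel)"
    proof (rule le_enn2real)
      have "ennreal (\<Sum>m\<in>J. \<Sum>j = 1..?n m. g m j) = (\<Sum>m\<in>J. \<Sum>j = 1..?n m. ennreal (g m j))"
        by (simp add: g_def sum_nonneg flip: sum_ennreal)
      also have "\<dots> = (\<Sum>m\<in>J. \<integral>\<^sup>+u\<in>{e m 0..<e m (?n m)}. ennreal (alloc p w m u) \<partial>lborel)"
      proof (rule sum.cong[OF refl])
        fix m assume m: "m \<in> J"
        have "(\<Sum>j = 1..?n m. ennreal (g m j)) =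
            (\<Sum>j = 1..?n m. \<integral>\<^sup>+u\<in>{e m (j - 1)..<e m j}. ennreal (alloc p w m u) \<partial>lborel)"
          unfolding g_def by (intro sum.cong refl ennreal_enn2real) (use g_fin[OF m] in simp)
        also have "\<dots> = (\<integral>\<^sup>+u\<in>{e m 0..<e m (?n m)}. ennreal (alloc p w m u) \<partial>lborel)"
          using nn_integral_intervals_sum[of "\<lambda>u. ennreal (alloc p w m u)" "?n m" "e m"]
            alloc_measurable[OF p w, of m] e(3)[OF m] by simp
        finally show "(\<Sum>j = 1..?n m. ennreal (g m j)) = \<dots>" .
      qed
      also have "\<dots> \<le> (\<Sum>m\<in>J. \<integral>\<^sup>+u\<in>{0..t}. ennreal (alloc p w m u) \<partial>lborel)"
      proof (intro sum_mono nn_integral_mono)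
        fix m u assume m: "m \<in> J"
        show "ennreal (alloc p w m u) * indicator {e m 0..<e m (?n m)} u \<le>
            ennreal (alloc p w m u) * indicator {0..t} u"
          using e(1,2)[OF m] compl(2)[OF m] arrival_nonneg[OF w, of m] by (auto split: split_indicator)
      qed
      also have "\<dots> = (\<integral>\<^sup>+u. (\<Sum>m\<in>J. ennreal (alloc p w m u) * indicator {0..t} u) \<partial>lborel)"
        using alloc_measurable[OF p w] by (intro nn_integral_sum[symmetric]) simp
      \<comment> \<open>At every instant the jobs in \<open>J\<close> together hold at most the
        rented GPUs.\<close>
      also have "\<dots> \<le> (\<integral>\<^sup>+u\<in>{0..t}. ennreal (rented p w u) \<partial>lborel)"
      proof (rule nn_integral_mono)
        fix u
        have "(\<Sum>m\<in>J. ennreal (alloc p w m u)) \<le> ennreal (rented p w u)"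
          using sum_alloc_le_rented[OF p w J, of u] alloc_nonneg[OF p w]
          by (simp add: sum_ennreal ennreal_leI)
        then show "(\<Sum>m\<in>J. ennreal (alloc p w m u) * indicator {0..t} u) \<le>
            ennreal (rented p w u) * indicator {0..t} u"
          by (auto split: split_indicator)
      qed
      finally show "ennreal (\<Sum>m\<in>J. \<Sum>j = 1..?n m. g m j) \<le>
          (\<integral>\<^sup>+u\<in>{0..t}. ennreal (rented p w u) \<partial>lborel)" .
    qed (use fin[of t] in auto)
    finally show "(\<Sum>i\<in>UNIV. \<Sum>j = 1..epochs R i. y i j * (X i j / speed R i j (y i j))) \<le>
      enn2real (\<integral>\<^sup>+u\<in>{0..t}. ennreal (rented p w u) \<partial>lborel)" .
  qed
qed

end

lemma jct_nonneg: "0 \<le> jct R p w m"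
  using epoch_end_ge_arrival[of R m w p "epochs R (jclass R m w)"]
  by (simp add: jct_def completion_def ereal_diff_positive)

lemma completion_eq_jct: "completion R p w m = ereal (arrival R m w) + jct R p w m"
  by (cases "completion R p w m") (simp_all add: jct_def)

section \<open>Finite long-run averages and the lower bound for arbitrary policies\<close>

context gpu_rental
begin

lemma eventually_arrived:
  assumes "regular w"
  shows "\<forall>\<^sub>F t in at_top. 0 < t \<and> 0 < card (arrived R w t)"
proof -
  have "\<forall>\<^sub>F t in at_top. 0 < real (card (arrived R w t)) / t"
    using order_tendstoD(1)[OF regular_count[OF assms] total_rate_pos] .
  then show ?thesis
    using eventually_gt_at_top[of 0] by eventually_elim (simp add: zero_less_divide_iff)
qed

text \<open>A single infinite JCT would make every average after that arrival infinite, so a finite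
  limit excludes it. Multiplying by the arrivals per unit of time turns the average over jobs into
  one over time.\<close>

lemma finite_average_jct:
  assumes reg: "regular w"
    and T: "((\<lambda>t. (\<Sum>m\<in>arrived R w t. jct R p w m) / ereal (real (card (arrived R w t)))) \<longlongrightarrow> T) at_top"
    and "T < \<infinity>"
  obtains D \<tau> where "T = ereal \<tau>" "\<And>m. 0 \<le> D m" "\<And>m. jct R p w m = ereal (D m)"
    "((\<lambda>t. (\<Sum>m\<in>arrived R w t. D m) / t) \<longlongrightarrow> \<tau> * total_rate R) at_top"
proof -
  have w: "w \<in> space (sample R)" using reg by (simp add: regular_def)
  obtain M where M: "T < ereal M" using \<open>T < \<infinity>\<close> ereal_dense2 by blast
  have fin: "jct R p w m < \<infinity>" for m
  proof -
    have "\<forall>\<^sub>F t in at_top. arrival R m w \<le> t \<and> (0 < t \<and> 0 < card (arrived R w t)) \<and>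
        (\<Sum>m\<in>arrived R w t. jct R p w m) / ereal (real (card (arrived R w t))) < ereal M"
      by (intro eventually_conj eventually_ge_at_top eventually_arrived[OF reg] order_tendstoD(2)[OF T M])
    then obtain t where t: "arrival R m w \<le> t" "0 < card (arrived R w t)"
        "(\<Sum>m\<in>arrived R w t. jct R p w m) / ereal (real (card (arrived R w t))) < ereal M"
      using eventually_happens' trivial_limit_at_top_linorder by blast
    have "(\<Sum>m\<in>arrived R w t. jct R p w m) \<noteq> \<infinity>"
    proof
      assume "(\<Sum>m\<in>arrived R w t. jct R p w m) = \<infinity>"
      then show False using t(2,3) by simp
    qed
    then have "jct R p w m \<noteq> \<infinity>"
      using t(1) arrived_finite[OF w, of t] by (auto simp: sum_Pinfty arrived_def)
    then show ?thesis by simp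
  qed
  define D where "D = (\<lambda>m. real_of_ereal (jct R p w m))"
  have jD: "jct R p w m = ereal (D m)" for m
    using jct_nonneg[of R p w m] fin[of m] unfolding D_def by (cases "jct R p w m") auto
  have D: "0 \<le> D m" for m using jct_nonneg[of R p w m] by (simp add: jD)
  have "((\<lambda>t. ereal ((\<Sum>m\<in>arrived R w t. D m) / real (card (arrived R w t)))) \<longlongrightarrow> T) at_top"
    using T by (rule Lim_transform_eventually)
      (use eventually_arrived[OF reg] in \<open>eventually_elim, simp add: jD\<close>)
  moreover from this have "0 \<le> T"
    by (rule tendsto_lowerbound) (auto intro!: always_eventually divide_nonneg_nonneg sum_nonneg D)
  then obtain \<tau> where \<tau>: "T = ereal \<tau>" using \<open>T < \<infinity>\<close> by (cases T) auto
  ultimately have "((\<lambda>t. (\<Sum>m\<in>arrived R w t. D m) / real (card (arrived R w t))) \<longlongrightarrow> \<tau>) at_top"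
    by simp
  from tendsto_mult[OF this regular_count[OF reg]]
  have "((\<lambda>t. (\<Sum>m\<in>arrived R w t. D m) / t) \<longlongrightarrow> \<tau> * total_rate R) at_top"
    by (rule Lim_transform_eventually) (use eventually_arrived[OF reg] in \<open>eventually_elim, simp\<close>)
  with \<tau> D jD show thesis by (intro that)
qed

text \<open>Rental cost is nondecreasing in time: once infinite it would stay so, against a limit of
  at most \<open>b\<close>.\<close>

lemma finite_operating_budget:
  fixes b :: real
  assumes C: "((\<lambda>t. enn2ereal (\<integral>\<^sup>+u\<in>{0..t}. ennreal (f u) \<partial>lborel) / ereal t) \<longlongrightarrow> C) at_top"
    and "C \<le> ereal b"
  obtains c where "c \<le> b" "\<And>t. (\<integral>\<^sup>+u\<in>{0..t}. ennreal (f u) \<partial>lborel) < \<infinity>"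
    "((\<lambda>t. enn2real (\<integral>\<^sup>+u\<in>{0..t}. ennreal (f u) \<partial>lborel) / t) \<longlongrightarrow> c) at_top"
proof -
  let ?I = "\<lambda>t. \<integral>\<^sup>+u\<in>{0..t}. ennreal (f u) \<partial>lborel"
  have "C < ereal (b + 1)" using \<open>C \<le> ereal b\<close> by (simp add: le_less_trans)
  have fin: "?I s < \<infinity>" for s
  proof -
    have "\<forall>\<^sub>F t in at_top. s \<le> t \<and> 0 < t \<and> enn2ereal (?I t) / ereal t < ereal (b + 1)"
      by (intro eventually_conj eventually_ge_at_top eventually_gt_at_top order_tendstoD(2)[OF C \<open>C < _\<close>])
    then obtain t where t: "s \<le> t" "0 < t" "enn2ereal (?I t) / ereal t < ereal (b + 1)"
      using eventually_happens' trivial_limit_at_top_linorder by blast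
    have "?I t \<noteq> top"
    proof
      assume "?I t = top"
      then show False using t(2,3) by simp
    qed
    moreover have "?I s \<le> ?I t"
      by (rule nn_integral_mono) (use t(1) in \<open>auto split: split_indicator\<close>)
    ultimately show ?thesis by (auto simp: less_top top_unique)
  qed
  have I: "enn2ereal (?I t) = ereal (enn2real (?I t))" for t
    using fin[of t] by (metis enn2ereal_ennreal enn2real_nonneg ennreal_enn2real infinity_ennreal_def)
  have C': "((\<lambda>t. ereal (enn2real (?I t) / t)) \<longlongrightarrow> C) at_top"
    using C unfolding I by (rule Lim_transform_eventually)
      (use eventually_gt_at_top[of 0] in \<open>eventually_elim, simp\<close>)
  have "\<forall>\<^sub>F t in at_top. 0 \<le> ereal (enn2real (?I t) / t)"
    using eventually_gt_at_top[of 0] by eventually_elim simp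
  with C' have "0 \<le> C" by (intro tendsto_lowerbound) auto
  then obtain c where c: "C = ereal c" using \<open>C \<le> ereal b\<close> by (cases C) auto
  with C' \<open>C \<le> ereal b\<close> fin show thesis by (intro that) auto
qed

text \<open>Jobs that arrive by (1 - \<epsilon>) t have left by \<open>t\<close> when
  \<open>t\<close> is large, and they carry almost all the work arriving by \<open>t\<close>.
  Pooling them at one such \<open>t\<close> gives the widths.\<close>

lemma policy_approximants:
  assumes reg: "regular w" and p: "policy R p"
    and C: "((\<lambda>t. enn2ereal (\<integral>\<^sup>+u\<in>{0..t}. ennreal (rented p w u) \<partial>lborel) / ereal t) \<longlongrightarrow> C) at_top" "C \<le> ereal b"
    and T: "((\<lambda>t. (\<Sum>m\<in>arrived R w t. jct R p w m) / ereal (real (card (arrived R w t)))) \<longlongrightarrow> ereal \<tau>) at_top"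
    and "0 < \<delta>"
  shows "\<exists>y\<in>widths R. width_jct R y \<le> \<tau> + \<delta> \<and> width_budget R y \<le> b + \<delta>"
proof -
  have w: "w \<in> space (sample R)" using reg by (simp add: regular_def)
  let ?\<Lambda> = "total_rate R"
  let ?I = "\<lambda>t. \<integral>\<^sup>+u\<in>{0..t}. ennreal (rented p w u) \<partial>lborel"
  from finite_average_jct[OF reg T] obtain D where D: "\<And>m. 0 \<le> D m" "\<And>m. jct R p w m = ereal (D m)"
    and limD: "((\<lambda>t. (\<Sum>m\<in>arrived R w t. D m) / t) \<longlongrightarrow> \<tau> * ?\<Lambda>) at_top" by auto
  from finite_operating_budget[OF C] obtain c where "c \<le> b" and fin: "\<And>t. ?I t < \<infinity>"
    and limI: "((\<lambda>t. enn2real (?I t) / t) \<longlongrightarrow> c) at_top" by blast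

  \<comment> \<open>The two quotients are the bounds obtained at the end: each numerator carries one
    \<epsilon> for a convergent average, and the factor 1 - 2 \<epsilon> accounts for the work left
    out of the pool.\<close>
  have "((\<lambda>\<epsilon>. (\<tau> * ?\<Lambda> + \<epsilon>) / ((1 - 2 * \<epsilon>) * ?\<Lambda>)) \<longlongrightarrow> \<tau>) (at_right 0)"
    using total_rate_pos by (auto intro!: tendsto_eq_intros)
  moreover have "((\<lambda>\<epsilon>. (b + \<epsilon>) / (1 - 2 * \<epsilon>)) \<longlongrightarrow> b) (at_right 0)"
    by (auto intro!: tendsto_eq_intros)
  ultimately have "\<forall>\<^sub>F \<epsilon> in at_right 0. \<epsilon> \<in> {0<..<1/2} \<and> (\<tau> * ?\<Lambda> + \<epsilon>) / ((1 - 2 * \<epsilon>) * ?\<Lambda>) < \<tau> + \<delta> \<and>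
      (b + \<epsilon>) / (1 - 2 * \<epsilon>) < b + \<delta>"
    using \<open>0 < \<delta>\<close> by (intro eventually_conj order_tendstoD(2) eventually_at_right_real) auto
  then obtain \<epsilon> where \<epsilon>: "0 < \<epsilon>" "\<epsilon> < 1/2" "(\<tau> * ?\<Lambda> + \<epsilon>) / ((1 - 2 * \<epsilon>) * ?\<Lambda>) < \<tau> + \<delta>"
      "(b + \<epsilon>) / (1 - 2 * \<epsilon>) < b + \<delta>"
    by (auto dest!: eventually_happens'[OF trivial_limit_at_right_real])

  define X where "X = (\<lambda>t i j. \<Sum>m\<in>arrived_class R w i ((1 - \<epsilon>) * t). work R m j w)"
  \<comment> \<open>One \<epsilon> is lost by stopping arrivals at (1 - \<epsilon>) t, the other by
    convergence of the average. Load 0 leaves no strict gap and is treated separately.\<close>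
  have X_large: "\<forall>\<^sub>F t in at_top. (1 - 2 * \<epsilon>) * load i j \<le> X t i j / t" if j: "j \<in> {1..epochs R i}" for i j
  proof (cases "load i j = 0")
    case True
    have "0 \<le> X t i j" for t unfolding X_def by (intro sum_nonneg work_nonneg w)
    then show ?thesis
      by (intro eventually_mono[OF eventually_gt_at_top[of 0]]) (simp add: True)
  next
    case False
    then have "(1 - 2 * \<epsilon>) * load i j < (1 - \<epsilon>) * load i j"
      using \<epsilon>(1) load_nonneg[OF j] by (intro mult_strict_right_mono) auto
    from order_tendstoD(1)[OF _ this] have "\<forall>\<^sub>F t in at_top. (1 - 2 * \<epsilon>) * load i j < X t i j / t"
      unfolding X_def using tendsto_time_scale[OF regular_class_work[OF reg j], of "1 - \<epsilon>"] \<epsilon> by simp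
    then show ?thesis by (auto elim: eventually_mono)
  qed
  have "\<forall>\<^sub>F t in at_top. \<forall>i\<in>UNIV. \<forall>j\<in>{1..epochs R i}. (1 - 2 * \<epsilon>) * load i j \<le> X t i j / t"
    by (intro eventually_ball_finite ballI X_large) auto
  moreover have "\<forall>\<^sub>F t in at_top. \<forall>m. arrival R m w \<le> t \<longrightarrow> D m \<le> \<epsilon> * t"
    using arrived_finite[OF w] limD \<open>0 < \<epsilon>\<close> unfolding arrived_def
    by (intro eventually_sojourn_le D) auto
  moreover have "\<forall>\<^sub>F t in at_top. (\<Sum>m\<in>arrived R w t. D m) / t < \<tau> * ?\<Lambda> + \<epsilon>"
    using \<epsilon>(1) by (intro order_tendstoD(2)[OF limD]) simp
  moreover have "\<forall>\<^sub>F t in at_top. enn2real (?I t) / t < b + \<epsilon>"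
    using \<epsilon>(1) \<open>c \<le> b\<close> by (intro order_tendstoD(2)[OF limI]) simp
  ultimately have "\<forall>\<^sub>F t in at_top. 0 < t \<and> (\<forall>i\<in>UNIV. \<forall>j\<in>{1..epochs R i}. (1 - 2 * \<epsilon>) * load i j \<le> X t i j / t) \<and>
      (\<forall>m. arrival R m w \<le> t \<longrightarrow> D m \<le> \<epsilon> * t) \<and> (\<Sum>m\<in>arrived R w t. D m) / t < \<tau> * ?\<Lambda> + \<epsilon> \<and>
      enn2real (?I t) / t < b + \<epsilon>"
    by (intro eventually_conj eventually_gt_at_top)
  then obtain t where t: "0 < t" "\<And>i j. j \<in> {1..epochs R i} \<Longrightarrow> (1 - 2 * \<epsilon>) * load i j \<le> X t i j / t"
      "\<And>m. arrival R m w \<le> t \<Longrightarrow> D m \<le> \<epsilon> * t" "(\<Sum>m\<in>arrived R w t. D m) / t < \<tau> * ?\<Lambda> + \<epsilon>"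
      "enn2real (?I t) / t < b + \<epsilon>"
    by (auto dest!: eventually_happens'[OF trivial_limit_at_top_linorder])

  define J where "J = arrived R w ((1 - \<epsilon>) * t)"
  have "(1 - \<epsilon>) * t \<le> t" using \<epsilon> t(1) by (simp add: algebra_simps)
  then have J: "J \<subseteq> arrived R w t" by (auto simp: J_def arrived_def)
  have X_eq: "X t i j = (\<Sum>m | m \<in> J \<and> jclass R m w = i. work R m j w)" for i j
    unfolding X_def J_def arrived_class_def by simp
  obtain y where y: "y \<in> widths R"
    "(\<Sum>i\<in>UNIV. \<Sum>j = 1..epochs R i. X t i j / speed R i j (y i j)) \<le> (\<Sum>m\<in>J. D m)"
    "(\<Sum>i\<in>UNIV. \<Sum>j = 1..epochs R i. y i j * (X t i j / speed R i j (y i j))) \<le> enn2real (?I t)"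
    unfolding X_eq
  proof (rule completed_jobs_widths[OF p w fin, of J D t])
    show "finite J" using arrived_finite[OF w] by (simp add: J_def)
    show "completion R p w m = ereal (arrival R m w + D m)" for m
      using completion_eq_jct[of R p w m] D(2)[of m] by simp
    show "arrival R m w + D m \<le> t" if "m \<in> J" for m
    proof -
      have "arrival R m w \<le> (1 - \<epsilon>) * t" using that by (simp add: J_def arrived_def)
      moreover from this have "D m \<le> \<epsilon> * t" using t(3) \<open>(1 - \<epsilon>) * t \<le> t\<close> by simp
      ultimately show ?thesis by (simp add: algebra_simps)
    qed
  qed
  have ypos: "0 < y i j" "0 < speed R i j (y i j)" if "j \<in> {1..epochs R i}" for i j
  proof -
    have "kmin R i \<le> y i j" using y(1) that by (auto simp: widths_def)
    then show "0 < y i j" "0 < speed R i j (y i j)"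
      using kmin_pos[of i] speed_pos[OF that] by auto
  qed
  \<comment> \<open>Nonnegative weights turn the lower bounds on pooled work into one on weighted
    sums; it serves for durations and for costs.\<close>
  have bound: "(1 - 2 * \<epsilon>) * (\<Sum>i\<in>UNIV. \<Sum>j = 1..epochs R i. load i j * a i j) \<le>
      (\<Sum>i\<in>UNIV. \<Sum>j = 1..epochs R i. a i j * X t i j) / t"
    if "\<And>i j. j \<in> {1..epochs R i} \<Longrightarrow> 0 \<le> a i j" for a
  proof -
    have "(1 - 2 * \<epsilon>) * (\<Sum>i\<in>UNIV. \<Sum>j = 1..epochs R i. load i j * a i j) =
        (\<Sum>i\<in>UNIV. \<Sum>j = 1..epochs R i. ((1 - 2 * \<epsilon>) * load i j) * a i j)"
      by (simp only: sum_distrib_left mult.assoc)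
    also have "\<dots> \<le> (\<Sum>i\<in>UNIV. \<Sum>j = 1..epochs R i. X t i j / t * a i j)"
      by (intro sum_mono mult_right_mono t(2) that)
    also have "\<dots> = (\<Sum>i\<in>UNIV. \<Sum>j = 1..epochs R i. a i j * X t i j) / t"
      by (simp add: sum_divide_distrib mult.commute)
    finally show ?thesis .
  qed
  have "(1 - 2 * \<epsilon>) * (\<Sum>i\<in>UNIV. \<Sum>j = 1..epochs R i. load i j * (1 / speed R i j (y i j))) \<le>
      (\<Sum>i\<in>UNIV. \<Sum>j = 1..epochs R i. X t i j / speed R i j (y i j)) / t"
    using bound[of "\<lambda>i j. 1 / speed R i j (y i j)"] ypos by (simp add: less_imp_le)
  also have "\<dots> \<le> (\<Sum>m\<in>arrived R w t. D m) / t"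
    using y(2) t(1) sum_mono2[OF arrived_finite[OF w] J, of D] D(1) by (intro divide_right_mono) auto
  also have "\<dots> \<le> \<tau> * ?\<Lambda> + \<epsilon>" using t(4) by simp
  finally have "width_jct R y \<le> (\<tau> * ?\<Lambda> + \<epsilon>) / ((1 - 2 * \<epsilon>) * ?\<Lambda>)"
    unfolding width_jct_eq divide_divide_eq_left[symmetric] using total_rate_pos \<epsilon>(2)
    by (intro divide_right_mono) (simp_all add: pos_le_divide_eq mult.commute)
  moreover have "(1 - 2 * \<epsilon>) * (\<Sum>i\<in>UNIV. \<Sum>j = 1..epochs R i. load i j * (y i j / speed R i j (y i j))) \<le>
      (\<Sum>i\<in>UNIV. \<Sum>j = 1..epochs R i. y i j * (X t i j / speed R i j (y i j))) / t"
    using bound[of "\<lambda>i j. y i j / speed R i j (y i j)"] ypos by (simp add: less_imp_le)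
  then have "(1 - 2 * \<epsilon>) * width_budget R y \<le> b + \<epsilon>"
    unfolding width_budget_eq[symmetric] using y(3) t(1,5)
    by (meson divide_right_mono less_imp_le order_trans)
  then have "width_budget R y \<le> (b + \<epsilon>) / (1 - 2 * \<epsilon>)"
    using \<epsilon>(2) by (simp add: pos_le_divide_eq mult.commute)
  ultimately show ?thesis using y(1) \<epsilon>(3,4) by (intro bexI[of _ y]) auto
qed

lemma policy_jct_lower_bound:
  assumes "regular w" "policy R p"
    and "((\<lambda>t. enn2ereal (\<integral>\<^sup>+u\<in>{0..t}. ennreal (rented p w u) \<partial>lborel) / ereal t) \<longlongrightarrow> C) at_top" "C \<le> ereal b"
    and T: "((\<lambda>t. (\<Sum>m\<in>arrived R w t. jct R p w m) / ereal (real (card (arrived R w t)))) \<longlongrightarrow> T) at_top"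
    and opt: "\<And>y. y \<in> widths R \<Longrightarrow> width_budget R y \<le> b \<Longrightarrow> v \<le> width_jct R y"
  shows "ereal v \<le> T"
proof (cases "T < \<infinity>")
  case True
  obtain \<tau> where \<tau>: "T = ereal \<tau>" using finite_average_jct[OF assms(1) T True] by blast
  have "v \<le> \<tau>"
    using policy_approximants[OF assms(1-4) T[unfolded \<tau>]]
    by (intro optimum_le_of_approximants[OF opt]) auto
  then show ?thesis by (simp add: \<tau>)
qed simp

end

section \<open>Fixed-width policies\<close>

text \<open>The order is left general: \<open>f\<close> stands both for the extended real epoch ends
  of a given policy and for the real ones of the policy constructed below.\<close>

lemma sum_consecutive_intervals:
  fixes f :: "nat \<Rightarrow> 'a::linorder" and k :: "nat \<Rightarrow> 'b::comm_monoid_add"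
  assumes mono: "\<And>a b. a \<le> b \<Longrightarrow> b \<le> n \<Longrightarrow> f a \<le> f b"
    and j: "j \<in> {1..n}" "f (j - 1) \<le> t" "t < f j"
  shows "(\<Sum>l\<in>{1..n}. if f (l - 1) \<le> t \<and> t < f l then k l else 0) = k j"
proof -
  have "\<not> (f (l - 1) \<le> t \<and> t < f l)" if "l \<in> {1..n}" "l \<noteq> j" for l
  proof (cases "l < j")
    case True
    then have "f l \<le> f (j - 1)" using j by (intro mono) auto
    then show ?thesis using j by auto
  next
    case False
    then have "f j \<le> f (l - 1)" using that j by (intro mono) auto
    then show ?thesis using j by auto
  qed
  then have "(\<Sum>l\<in>{1..n}. if f (l - 1) \<le> t \<and> t < f l then k l else 0) = (\<Sum>l\<in>{1..n}. if l = j then k j else 0)"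
    using j by (intro sum.cong) auto
  then show ?thesis using j(1) by simp
qed

section \<open>Epoch ends under constant widths\<close>

context gpu_rental
begin

text \<open>At rate \<open>s\<close> the work processed reaches the inherent work exactly at
  \<open>E\<close>. The width is prescribed only before the predicted end \<open>E\<close>, so no
  knowledge of the actual end is presupposed.\<close>

lemma epoch_end_constant:
  assumes j: "Suc j \<in> {1..epochs R (jclass R m w)}" and k: "kmin R (jclass R m w) \<le> k"
    and e: "epoch_end R p w m j = ereal e" and w: "w \<in> space (sample R)"
  defines "s \<equiv> speed R (jclass R m w) (Suc j) k"
  defines "E \<equiv> e + work R m (Suc j) w / s"
  assumes const: "\<And>u. e \<le> u \<Longrightarrow> u < E \<Longrightarrow> alloc p w m u = k"
  shows "epoch_end R p w m (Suc j) = ereal E"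
proof -
  let ?r = "\<lambda>u. proc_rate R (jclass R m w) (Suc j) (alloc p w m u)"
  have s: "0 < s" unfolding s_def by (rule speed_pos[OF j k])
  have "e \<le> E" using work_nonneg[OF w] s by (simp add: E_def)
  have int: "(\<integral>\<^sup>+u\<in>{e..t}. ennreal (?r u) \<partial>lborel) = ennreal (s * (t - e))" if "e \<le> t" "t \<le> E" for t
  proof -
    have "(\<integral>\<^sup>+u\<in>{e..<t}. ennreal (?r u) \<partial>lborel) = (\<integral>\<^sup>+u. ennreal s * indicator {e..<t} u \<partial>lborel)"
      using const that k by (intro nn_integral_cong) (auto split: split_indicator simp: proc_rate_def s_def)
    then show ?thesis using that s by (simp add: nn_integral_Icc_eq_Ico ennreal_mult nn_integral_cmult_indicator)
  qed
  have sE: "s * (E - e) = work R m (Suc j) w" using s by (simp add: E_def)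
  have "Inf {ereal t | t. e \<le> t \<and> ennreal (work R m (Suc j) w) \<le> (\<integral>\<^sup>+u\<in>{e..t}. ennreal (?r u) \<partial>lborel)} = ereal E"
  proof (rule Inf_eqI)
    fix y assume "y \<in> {ereal t | t. e \<le> t \<and> ennreal (work R m (Suc j) w) \<le> (\<integral>\<^sup>+u\<in>{e..t}. ennreal (?r u) \<partial>lborel)}"
    then obtain t where t: "y = ereal t" "e \<le> t" "ennreal (work R m (Suc j) w) \<le> (\<integral>\<^sup>+u\<in>{e..t}. ennreal (?r u) \<partial>lborel)"
      by blast
    have "E \<le> t"
    proof (rule ccontr)
      assume "\<not> E \<le> t"
      then have "ennreal (s * (E - e)) \<le> ennreal (s * (t - e))" using int[of t] t sE by simp
      then have "s * (E - e) \<le> s * (t - e)" using s t(2) by (subst (asm) ennreal_le_iff) auto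
      then show False using s \<open>\<not> E \<le> t\<close> by simp
    qed
    then show "ereal E \<le> y" by (simp add: t(1))
  next
    fix y assume "\<And>i. i \<in> {ereal t | t. e \<le> t \<and> ennreal (work R m (Suc j) w) \<le> (\<integral>\<^sup>+u\<in>{e..t}. ennreal (?r u) \<partial>lborel)} \<Longrightarrow> y \<le> i"
    then show "y \<le> ereal E" using int[OF \<open>e \<le> E\<close>] sE \<open>e \<le> E\<close> by auto
  qed
  then show ?thesis unfolding epoch_end_Suc_eq[OF e] .
qed

text \<open>The epoch ends in closed form, without reference to a policy; this breaks the circle
  between \<open>alloc\<close> and \<open>epoch_end\<close>.\<close>

definition width_end :: "('c \<Rightarrow> nat \<Rightarrow> real) \<Rightarrow> 'w \<Rightarrow> nat \<Rightarrow> nat \<Rightarrow> real" where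
  "width_end k w m j = arrival R m w +
    (\<Sum>l = 1..j. work R m l w / speed R (jclass R m w) l (k (jclass R m w) l))"

lemma width_end_Suc:
  "width_end k w m (Suc j) =
    width_end k w m j + work R m (Suc j) w / speed R (jclass R m w) (Suc j) (k (jclass R m w) (Suc j))"
  by (simp add: width_end_def)

lemma width_end_mono:
  assumes "k \<in> widths R" "w \<in> space (sample R)" "a \<le> b" "b \<le> epochs R (jclass R m w)"
  shows "width_end k w m a \<le> width_end k w m b"
proof -
  have "0 \<le> work R m l w / speed R (jclass R m w) l (k (jclass R m w) l)" if "l \<in> {1..b}" for l
  proof -
    have l: "l \<in> {1..epochs R (jclass R m w)}" using that assms(4) by simp
    then have "kmin R (jclass R m w) \<le> k (jclass R m w) l" using assms(1) by (auto simp: widths_def)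
    from speed_pos[OF l this] show ?thesis using work_nonneg[OF assms(2)] by simp
  qed
  then show ?thesis
    unfolding width_end_def using assms(3) by (intro add_left_mono sum_mono2) auto
qed

lemma fixed_width_alloc:
  assumes "fixed_width R k p" "w \<in> space (sample R)" "j \<in> {1..epochs R (jclass R m w)}"
    and "epoch_end R p w m (j - 1) \<le> ereal t" "ereal t < epoch_end R p w m j"
  shows "alloc p w m t = k (jclass R m w) j"
proof -
  have "alloc p w m t = (\<Sum>j\<in>{1..epochs R (jclass R m w)}.
      if epoch_end R p w m (j - 1) \<le> ereal t \<and> ereal t < epoch_end R p w m j
      then k (jclass R m w) j else 0)"
    using assms(1,2) unfolding fixed_width_def by blast
  also have "\<dots> = k (jclass R m w) j"
    by (rule sum_consecutive_intervals) (use assms epoch_end_mono in auto)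
  finally show ?thesis .
qed

text \<open>The policy holds its width only until the actual end of the epoch. That end cannot
  precede the predicted one, since the work done at the given speed would not suffice; hence the
  width is held up to the predicted end and \<open>epoch_end_constant\<close> applies.\<close>

lemma fixed_width_epoch_end:
  assumes p: "fixed_width R k p" and w: "w \<in> space (sample R)"
  shows "j \<le> epochs R (jclass R m w) \<Longrightarrow> epoch_end R p w m j = ereal (width_end k w m j)"
proof (induction j)
  case 0
  then show ?case by (simp add: width_end_def)
next
  case (Suc j)
  let ?i = "jclass R m w"
  have pol: "policy R p" and kw: "k \<in> widths R" using p by (auto simp: fixed_width_def)
  have j: "Suc j \<in> {1..epochs R ?i}" using Suc.prems by simp
  have k: "kmin R ?i \<le> k ?i l" if "l \<in> {1..epochs R ?i}" for l using kw that by (auto simp: widths_def)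
  let ?e = "width_end k w m j" and ?s = "speed R ?i (Suc j) (k ?i (Suc j))"
  let ?r = "\<lambda>u. proc_rate R ?i (Suc j) (alloc p w m u)"
  note [measurable] = alloc_measurable[OF pol w, of m] proc_rate_measurable[OF j]
  have e: "epoch_end R p w m j = ereal ?e" using Suc by simp
  have s: "0 < ?s" by (rule speed_pos[OF j k[OF j]])
  have alloc: "alloc p w m u = k ?i (Suc j)" if "?e \<le> u" "ereal u < epoch_end R p w m (Suc j)" for u
    using fixed_width_alloc[OF p w j] that e by simp
  have F: "ereal (width_end k w m (Suc j)) \<le> epoch_end R p w m (Suc j)"
  proof (cases "epoch_end R p w m (Suc j)")
    case (real f)
    have "?e \<le> f" using epoch_end_Suc_mono[of R p w m j] e real by simp
    \<comment> \<open>Past \<open>f\<close> the job may already be in a later epoch; the sum of all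
      its widths is a crude bound that gives finiteness up to \<open>f + 1\<close>.\<close>
    have bounded: "?r u \<le> proc_rate R ?i (Suc j) (\<Sum>l\<in>{1..epochs R ?i}. k ?i l)" for u
    proof (rule proc_rate_mono[OF j])
      have "alloc p w m u = (\<Sum>j\<in>{1..epochs R ?i}.
          if epoch_end R p w m (j - 1) \<le> ereal u \<and> ereal u < epoch_end R p w m j then k ?i j else 0)"
        using p w unfolding fixed_width_def by blast
      also have "\<dots> \<le> (\<Sum>l\<in>{1..epochs R ?i}. k ?i l)"
      proof (rule sum_mono)
        fix l assume "l \<in> {1..epochs R ?i}"
        from k[OF this] kmin_pos[of ?i] show "(if epoch_end R p w m (l - 1) \<le> ereal u \<and>
            ereal u < epoch_end R p w m l then k ?i l else 0) \<le> k ?i l" by simp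
      qed
      finally show "alloc p w m u \<le> (\<Sum>l\<in>{1..epochs R ?i}. k ?i l)" .
    qed
    have "ennreal (work R m (Suc j) w) \<le> (\<integral>\<^sup>+u\<in>{?e..f}. ennreal (?r u) \<partial>lborel)"
    proof (rule epoch_end_attained[OF e real])
      have "(\<integral>\<^sup>+u\<in>{?e..f + 1}. ennreal (?r u) \<partial>lborel) \<le>
          (\<integral>\<^sup>+u. ennreal (proc_rate R ?i (Suc j) (\<Sum>l\<in>{1..epochs R ?i}. k ?i l)) * indicator {?e..f + 1} u \<partial>lborel)"
        by (intro nn_integral_mono mult_right_mono ennreal_leI bounded) simp
      also have "\<dots> < \<infinity>" by (simp add: nn_integral_cmult_indicator ennreal_mult_less_top emeasure_lborel_Icc_eq)
      finally show "(\<integral>\<^sup>+u\<in>{?e..f + 1}. ennreal (?r u) \<partial>lborel) < \<infinity>" .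
    qed measurable
    also have "\<dots> = (\<integral>\<^sup>+u. ennreal ?s * indicator {?e..<f} u \<partial>lborel)"
      unfolding nn_integral_Icc_eq_Ico using alloc real k[OF j]
      by (intro nn_integral_cong) (auto split: split_indicator simp: proc_rate_def)
    also have "\<dots> = ennreal (?s * (f - ?e))"
      using \<open>?e \<le> f\<close> s by (simp add: nn_integral_cmult_indicator ennreal_mult)
    finally have "work R m (Suc j) w \<le> ?s * (f - ?e)"
      using \<open>?e \<le> f\<close> s by (subst (asm) ennreal_le_iff) auto
    then have "width_end k w m (Suc j) \<le> f" using s by (simp add: width_end_Suc field_simps)
    then show ?thesis using real by simp
  next
    case MInf
    then show ?thesis using epoch_end_ge_arrival[of R m w p "Suc j"] by simp
  qed simp
  have "alloc p w m u = k ?i (Suc j)" if "?e \<le> u" "u < width_end k w m (Suc j)" for u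
    by (rule alloc[OF that(1) less_le_trans[OF _ F]]) (simp add: that(2))
  then show ?case
    using epoch_end_constant[OF j k[OF j] e w] by (simp add: width_end_Suc)
qed

text \<open>The allocation is defined from the closed-form ends, and the epoch ends it produces are
  then shown to be these by induction over the epochs.\<close>

lemma fixed_width_exists:
  assumes k: "k \<in> widths R"
  shows "\<exists>p. fixed_width R k p"
proof -
  let ?n = "\<lambda>w m. epochs R (jclass R m w)"
  let ?E = "width_end k"
  define al where "al = (\<lambda>w m t. \<Sum>j\<in>{1..?n w m}.
    if ?E w m (j - 1) \<le> t \<and> t < ?E w m j then k (jclass R m w) j else 0)"
  define p where "p = \<lparr>rented = \<lambda>w t. \<Sum>m\<in>arrived R w t. al w m t, alloc = al\<rparr>"
  have kmin: "kmin R i \<le> k i l" if "l \<in> {1..epochs R i}" for i l using k that by (auto simp: widths_def)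
  have al_eq: "al w m t = k (jclass R m w) j"
    if "w \<in> space (sample R)" "j \<in> {1..?n w m}" "?E w m (j - 1) \<le> t" "t < ?E w m j" for w m j t
    unfolding al_def by (rule sum_consecutive_intervals) (use that width_end_mono[OF k] in auto)
  have al_nz: "\<exists>j\<in>{1..?n w m}. ?E w m (j - 1) \<le> t \<and> t < ?E w m j" if "al w m t \<noteq> 0" for w m t
  proof (rule ccontr)
    assume *: "\<not> ?thesis"
    have "al w m t = 0" unfolding al_def by (rule sum.neutral) (use * in auto)
    with that show False by simp
  qed
  have E: "epoch_end R p w m j = ereal (?E w m j)" if "w \<in> space (sample R)" "j \<le> ?n w m" for w m j
    using that(2)
  proof (induction j)
    case 0
    then show ?case by (simp add: width_end_def)
  next
    case (Suc j)
    then have j: "Suc j \<in> {1..?n w m}" by simp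
    have "alloc p w m u = k (jclass R m w) (Suc j)" if "?E w m j \<le> u" "u < ?E w m (Suc j)" for u
      using al_eq[OF \<open>w \<in> _\<close> j] that by (simp add: p_def)
    then show ?case
      using epoch_end_constant[OF j kmin[OF j], of p "?E w m j"] Suc \<open>w \<in> _\<close> by (simp add: width_end_Suc)
  qed
  have "policy R p"
    unfolding policy_def
  proof (intro ballI conjI allI)
    fix w assume w: "w \<in> space (sample R)"
    have al_arrived: "arrival R m w \<le> t \<and> t < ?E w m (?n w m)" if nz: "al w m t \<noteq> 0" for m t
    proof -
      obtain j where j: "j \<in> {1..?n w m}" "?E w m (j - 1) \<le> t" "t < ?E w m j" using al_nz[OF nz] by blast
      have "?E w m 0 \<le> ?E w m (j - 1)" "?E w m j \<le> ?E w m (?n w m)"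
        using j(1) by (auto intro!: width_end_mono[OF k w])
      then show ?thesis using j by (simp add: width_end_def)
    qed
    have meas: "al w m \<in> borel_measurable borel" for m unfolding al_def by measurable
    then show "alloc p w m \<in> borel_measurable borel" for m by (simp add: p_def)
    \<comment> \<open>The range of the sum varies with \<open>t\<close>; as a series over all jobs
      the rented number is visibly measurable.\<close>
    have "(\<Sum>m\<in>arrived R w t. al w m t) = (\<Sum>m. al w m t)" for t
      using al_arrived[of _ t] arrived_finite[OF w, of t]
      by (intro suminf_finite[symmetric]) (auto simp: arrived_def)
    then show "rented p w \<in> borel_measurable borel"
      using borel_measurable_suminf[OF meas] by (simp add: p_def)
    show "alloc p w m t = 0 \<or> kmin R (jclass R m w) \<le> alloc p w m t" for m t
    proof (cases "al w m t = 0")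
      case False
      then obtain j where j: "j \<in> {1..?n w m}" "?E w m (j - 1) \<le> t" "t < ?E w m j"
        using al_nz by blast
      show ?thesis using al_eq[OF w j] kmin[OF j(1)] by (simp add: p_def)
    qed (simp add: p_def)
    show "alloc p w m t \<noteq> 0 \<longrightarrow> arrival R m w \<le> t \<and> ereal t < completion R p w m" for m t
      using al_arrived[of m t] E[OF w, of "?n w m" m] by (auto simp: p_def completion_def)
    show "(\<Sum>m\<in>arrived R w t. alloc p w m t) \<le> rented p w t" for t by (simp add: p_def)
  qed
  moreover have "alloc p w m t = (\<Sum>j\<in>{1..?n w m}.
      if epoch_end R p w m (j - 1) \<le> ereal t \<and> ereal t < epoch_end R p w m j
      then k (jclass R m w) j else 0)" if w: "w \<in> space (sample R)" for w m t
  proof -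
    have "alloc p w m t = al w m t" by (simp add: p_def)
    also have "\<dots> = (\<Sum>j\<in>{1..?n w m}.
      if epoch_end R p w m (j - 1) \<le> ereal t \<and> ereal t < epoch_end R p w m j
      then k (jclass R m w) j else 0)"
      unfolding al_def
    proof (rule sum.cong[OF refl])
      fix j assume "j \<in> {1..?n w m}"
      then have "epoch_end R p w m (j - 1) = ereal (?E w m (j - 1))" "epoch_end R p w m j = ereal (?E w m j)"
        by (auto intro!: E[OF w])
      then show "(if ?E w m (j - 1) \<le> t \<and> t < ?E w m j then k (jclass R m w) j else 0) =
          (if epoch_end R p w m (j - 1) \<le> ereal t \<and> ereal t < epoch_end R p w m j
          then k (jclass R m w) j else 0)" by simp
    qed
    finally show ?thesis .
  qed
  ultimately have "fixed_width R k p" using k by (simp add: fixed_width_def p_def)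
  then show ?thesis ..
qed

section \<open>Metrics of fixed-width policies\<close>

lemma fixed_width_jct:
  assumes "fixed_width R k p" "w \<in> space (sample R)"
  shows "jct R p w m = ereal (\<Sum>j = 1..epochs R (jclass R m w).
    1 / speed R (jclass R m w) j (k (jclass R m w) j) * work R m j w)"
  using fixed_width_epoch_end[OF assms order_refl, of m]
  by (simp add: jct_def completion_def width_end_def)

lemma fixed_width_average_jct:
  assumes p: "fixed_width R k p"
  shows "has_average_jct R p (\<lambda>_. ereal (width_jct R k))"
  unfolding has_average_jct_def using AE_regular
proof eventually_elim
  case (elim w)
  then have w: "w \<in> space (sample R)" by (simp add: regular_def)
  define D where "D = (\<lambda>m. \<Sum>j = 1..epochs R (jclass R m w).
    1 / speed R (jclass R m w) j (k (jclass R m w) j) * work R m j w)"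
  have "((\<lambda>t. ((\<Sum>m\<in>arrived R w t. D m) / t) / (real (card (arrived R w t)) / t)) \<longlongrightarrow> width_jct R k) at_top"
    unfolding width_jct_eq D_def
    using total_rate_pos by (intro tendsto_divide regular_average regular_count elim) auto
  then have "((\<lambda>t. ereal (((\<Sum>m\<in>arrived R w t. D m) / t) / (real (card (arrived R w t)) / t))) \<longlongrightarrow>
      ereal (width_jct R k)) at_top" by simp
  then show ?case
    by (rule Lim_transform_eventually)
      (use eventually_arrived[OF elim] in \<open>eventually_elim, simp add: fixed_width_jct[OF p w] D_def\<close>)
qed

text \<open>\<open>c m\<close> is the GPU time of job \<open>m\<close> over its whole stay. Any time
  window uses at most that much, and a window from 0 to beyond completion uses all of it.\<close>

lemma fixed_width_job_cost:
  assumes p: "fixed_width R k p" and w: "w \<in> space (sample R)"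
  defines "c \<equiv> \<lambda>m. \<Sum>j = 1..epochs R (jclass R m w).
    k (jclass R m w) j / speed R (jclass R m w) j (k (jclass R m w) j) * work R m j w"
  shows "0 \<le> c m"
    and "(\<integral>\<^sup>+u\<in>{0..t}. ennreal (alloc p w m u) \<partial>lborel) \<le> ennreal (c m)"
    and "completion R p w m \<le> ereal t \<Longrightarrow> ennreal (c m) \<le> (\<integral>\<^sup>+u\<in>{0..t}. ennreal (alloc p w m u) \<partial>lborel)"
proof -
  let ?i = "jclass R m w" and ?E = "width_end k w m"
  let ?n = "epochs R ?i"
  have pol: "policy R p" and kw: "k \<in> widths R" using p by (auto simp: fixed_width_def)
  have kpos: "0 < k ?i j" "0 < speed R ?i j (k ?i j)" if "j \<in> {1..?n}" for j
  proof -
    have "kmin R ?i \<le> k ?i j" using kw that by (auto simp: widths_def)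
    then show "0 < k ?i j" "0 < speed R ?i j (k ?i j)" using kmin_pos[of ?i] speed_pos[OF that] by auto
  qed
  have c_nonneg: "0 \<le> k ?i j / speed R ?i j (k ?i j) * work R m j w" if "j \<in> {1..?n}" for j
    using kpos[OF that] work_nonneg[OF w, of m j] by simp
  show "0 \<le> c m" unfolding c_def by (rule sum_nonneg[OF c_nonneg])
  have "(\<integral>\<^sup>+u\<in>{?E (j - 1)..<?E j}. ennreal (alloc p w m u) \<partial>lborel) =
      ennreal (k ?i j / speed R ?i j (k ?i j) * work R m j w)" if j: "j \<in> {1..?n}" for j
  proof -
    have "(\<integral>\<^sup>+u\<in>{?E (j - 1)..<?E j}. ennreal (alloc p w m u) \<partial>lborel) =
        (\<integral>\<^sup>+u. ennreal (k ?i j) * indicator {?E (j - 1)..<?E j} u \<partial>lborel)"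
      using fixed_width_alloc[OF p w j] fixed_width_epoch_end[OF p w, of j m]
        fixed_width_epoch_end[OF p w, of "j - 1" m] j
      by (intro nn_integral_cong) (auto split: split_indicator)
    also have "\<dots> = ennreal (k ?i j) * ennreal (?E j - ?E (j - 1))"
      using width_end_mono[OF kw w, of "j - 1" j m] j by (simp add: nn_integral_cmult_indicator)
    also have "?E j - ?E (j - 1) = work R m j w / speed R ?i j (k ?i j)"
      using width_end_Suc[of k w m "j - 1"] j by simp
    finally show ?thesis using kpos[OF j] work_nonneg[OF w, of m j] by (simp flip: ennreal_mult')
  qed
  then have "(\<Sum>j = 1..?n. \<integral>\<^sup>+u\<in>{?E (j - 1)..<?E j}. ennreal (alloc p w m u) \<partial>lborel) =
      (\<Sum>j = 1..?n. ennreal (k ?i j / speed R ?i j (k ?i j) * work R m j w))"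
    by (intro sum.cong refl)
  also have "\<dots> = ennreal (c m)" unfolding c_def by (rule sum_ennreal[OF c_nonneg])
  finally have "(\<Sum>j = 1..?n. \<integral>\<^sup>+u\<in>{?E (j - 1)..<?E j}. ennreal (alloc p w m u) \<partial>lborel) = ennreal (c m)" .
  moreover have "?E j \<le> ?E (Suc j)" if "j < ?n" for j
    using width_end_mono[OF kw w, of j "Suc j" m] that by simp
  then have "(\<Sum>j = 1..?n. \<integral>\<^sup>+u\<in>{?E (j - 1)..<?E j}. ennreal (alloc p w m u) \<partial>lborel) =
      (\<integral>\<^sup>+u\<in>{?E 0..<?E ?n}. ennreal (alloc p w m u) \<partial>lborel)"
    using nn_integral_intervals_sum[of "\<lambda>u. ennreal (alloc p w m u)" ?n ?E] alloc_measurable[OF pol w, of m]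
    by simp
  ultimately have c: "ennreal (c m) = (\<integral>\<^sup>+u\<in>{?E 0..<?E ?n}. ennreal (alloc p w m u) \<partial>lborel)" by simp
  have compl: "completion R p w m = ereal (?E ?n)"
    using fixed_width_epoch_end[OF p w order_refl] by (simp add: completion_def)
  have zero: "alloc p w m u = 0 \<or> ?E 0 \<le> u \<and> u < ?E ?n" for u
  proof -
    have "alloc p w m u \<noteq> 0 \<longrightarrow> arrival R m w \<le> u \<and> ereal u < completion R p w m"
      using pol w unfolding policy_def by blast
    then show ?thesis by (auto simp: compl width_end_def[of k w m 0])
  qed
  show "(\<integral>\<^sup>+u\<in>{0..t}. ennreal (alloc p w m u) \<partial>lborel) \<le> ennreal (c m)"
    unfolding c
  proof (rule nn_integral_mono)
    fix u
    show "ennreal (alloc p w m u) * indicator {0..t} u \<le> ennreal (alloc p w m u) * indicator {?E 0..<?E ?n} u"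
      using zero[of u] by (auto split: split_indicator)
  qed
  show "ennreal (c m) \<le> (\<integral>\<^sup>+u\<in>{0..t}. ennreal (alloc p w m u) \<partial>lborel)" if "completion R p w m \<le> ereal t"
    unfolding c using that compl arrival_nonneg[OF w, of m]
    by (intro nn_integral_mono) (auto split: split_indicator simp: width_end_def)
qed

text \<open>For large \<open>t\<close>, the rental cost up to \<open>t\<close> lies between the
  total costs of the jobs arrived by (1 - \<epsilon>) t and by \<open>t\<close>, whose time averages
  differ by a factor tending to 1 with \<epsilon>.\<close>

lemma fixed_width_operating_budget:
  assumes p: "fixed_width R k p"
  shows "has_operating_budget R p (\<lambda>_. ereal (width_budget R k))"
  unfolding has_operating_budget_def using AE_regular
proof eventually_elim
  case (elim w)
  then have w: "w \<in> space (sample R)" by (simp add: regular_def)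
  have pol: "policy R p" and kw: "k \<in> widths R" using p by (auto simp: fixed_width_def)
  let ?I = "\<lambda>t. \<integral>\<^sup>+u\<in>{0..t}. ennreal (rented p w u) \<partial>lborel"
  define c where "c = (\<lambda>m. \<Sum>j = 1..epochs R (jclass R m w).
    k (jclass R m w) j / speed R (jclass R m w) j (k (jclass R m w) j) * work R m j w)"
  define D where "D = (\<lambda>m. \<Sum>j = 1..epochs R (jclass R m w).
    1 / speed R (jclass R m w) j (k (jclass R m w) j) * work R m j w)"
  have cost: "0 \<le> c m" "(\<integral>\<^sup>+u\<in>{0..t}. ennreal (alloc p w m u) \<partial>lborel) \<le> ennreal (c m)"
    "completion R p w m \<le> ereal t \<Longrightarrow> ennreal (c m) \<le> (\<integral>\<^sup>+u\<in>{0..t}. ennreal (alloc p w m u) \<partial>lborel)"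
    for m t unfolding c_def by (fact fixed_width_job_cost[OF p w])+
  have jct: "jct R p w m = ereal (D m)" for m using fixed_width_jct[OF p w] by (simp add: D_def)
  \<comment> \<open>Jobs arriving after \<open>u\<close> hold no GPUs at \<open>u\<close>, so the
    range of the sum can be fixed to the arrivals by \<open>t\<close> before sum and integral are
    exchanged.\<close>
  have I: "?I t = (\<Sum>m\<in>arrived R w t. \<integral>\<^sup>+u\<in>{0..t}. ennreal (alloc p w m u) \<partial>lborel)" for t
  proof -
    have "ennreal (rented p w u) * indicator {0..t} u =
        (\<Sum>m\<in>arrived R w t. ennreal (alloc p w m u) * indicator {0..t} u)" for u
    proof (cases "u \<le> t")
      case True
      have "rented p w u = (\<Sum>m\<in>arrived R w u. alloc p w m u)"
        using p w unfolding fixed_width_def by blast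
      also have "\<dots> = (\<Sum>m\<in>arrived R w t. alloc p w m u)"
        by (rule sum.mono_neutral_left)
          (use True arrived_finite[OF w] alloc_before_arrival[OF pol w] in \<open>auto simp: arrived_def\<close>)
      finally show ?thesis
        using alloc_nonneg[OF pol w] by (auto split: split_indicator simp: sum_ennreal)
    qed simp
    then show ?thesis
      using alloc_measurable[OF pol w] by (simp add: nn_integral_sum)
  qed
  have upper: "?I t \<le> ennreal (\<Sum>m\<in>arrived R w t. c m)" for t
    unfolding I sum_ennreal[OF cost(1), symmetric] by (intro sum_mono cost(2))
  have fin: "?I t < \<infinity>" for t using upper[of t] by (simp add: le_less_trans)
  have limS: "((\<lambda>t. (\<Sum>m\<in>arrived R w t. c m) / t) \<longlongrightarrow> width_budget R k) at_top"
    unfolding c_def width_budget_eq by (rule regular_average[OF elim])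
  have limD: "((\<lambda>t. (\<Sum>m\<in>arrived R w t. D m) / t) \<longlongrightarrow>
      (\<Sum>i\<in>UNIV. \<Sum>j = 1..epochs R i. load i j * (1 / speed R i j (k i j)))) at_top"
    unfolding D_def by (rule regular_average[OF elim])
  have lower: "\<forall>\<^sub>F t in at_top. (\<Sum>m\<in>arrived R w ((1 - \<epsilon>) * t). c m) \<le> enn2real (?I t)"
    if \<epsilon>: "0 < \<epsilon>" "\<epsilon> < 1" for \<epsilon>
  proof -
    have D: "0 \<le> D m" for m using jct_nonneg[of R p w m] by (simp add: jct)
    have "\<forall>\<^sub>F t in at_top. \<forall>m. arrival R m w \<le> t \<longrightarrow> D m \<le> \<epsilon> * t"
      using arrived_finite[OF w] limD \<epsilon>(1) unfolding arrived_def by (intro eventually_sojourn_le D) auto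
    then show ?thesis
      using eventually_gt_at_top[of 0]
    proof eventually_elim
      case (elim t)
      have le: "(1 - \<epsilon>) * t \<le> t" using \<epsilon> elim(2) by (simp add: algebra_simps)
      have compl: "completion R p w m \<le> ereal t" if "m \<in> arrived R w ((1 - \<epsilon>) * t)" for m
      proof -
        have "arrival R m w \<le> (1 - \<epsilon>) * t" using that by (simp add: arrived_def)
        moreover from this have "D m \<le> \<epsilon> * t" using elim(1) le by simp
        ultimately show ?thesis unfolding completion_eq_jct jct by (simp add: algebra_simps)
      qed
      have "ennreal (\<Sum>m\<in>arrived R w ((1 - \<epsilon>) * t). c m) =
          (\<Sum>m\<in>arrived R w ((1 - \<epsilon>) * t). ennreal (c m))" using cost(1) by (simp add: sum_ennreal)
      also have "\<dots> \<le> (\<Sum>m\<in>arrived R w ((1 - \<epsilon>) * t). \<integral>\<^sup>+u\<in>{0..t}. ennreal (alloc p w m u) \<partial>lborel)"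
        by (intro sum_mono cost(3) compl)
      also have "\<dots> \<le> ?I t"
        unfolding I using le arrived_finite[OF w] by (intro sum_mono2) (auto simp: arrived_def)
      finally show ?case using fin by (intro le_enn2real)
    qed
  qed
  have "((\<lambda>t. enn2real (?I t) / t) \<longlongrightarrow> width_budget R k) at_top"
  proof (rule order_tendstoI)
    fix a assume a: "a < width_budget R k"
    have "((\<lambda>\<epsilon>. (1 - \<epsilon>) * width_budget R k) \<longlongrightarrow> width_budget R k) (at_right 0)"
      by (auto intro!: tendsto_eq_intros)
    then have "\<forall>\<^sub>F \<epsilon> in at_right 0. \<epsilon> \<in> {0<..<1} \<and> a < (1 - \<epsilon>) * width_budget R k"
      using a by (intro eventually_conj order_tendstoD(1) eventually_at_right_real) auto
    then obtain \<epsilon> where \<epsilon>: "\<epsilon> \<in> {0<..<1}" "a < (1 - \<epsilon>) * width_budget R k"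
      using eventually_happens'[OF trivial_limit_at_right_real] by blast
    have "\<forall>\<^sub>F t in at_top. a < (\<Sum>m\<in>arrived R w ((1 - \<epsilon>) * t). c m) / t"
      using order_tendstoD(1)[OF tendsto_time_scale[OF limS] \<epsilon>(2)] \<epsilon>(1) by simp
    moreover have "\<forall>\<^sub>F t in at_top. (\<Sum>m\<in>arrived R w ((1 - \<epsilon>) * t). c m) \<le> enn2real (?I t)"
      using \<epsilon>(1) by (intro lower) auto
    ultimately show "\<forall>\<^sub>F t in at_top. a < enn2real (?I t) / t"
      using eventually_gt_at_top[of 0]
      by eventually_elim (meson divide_right_mono less_imp_le less_le_trans)
  next
    fix a assume a: "width_budget R k < a"
    have le: "enn2real (?I t) \<le> (\<Sum>m\<in>arrived R w t. c m)" for t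
      using upper[of t] cost(1) by (intro enn2real_leI sum_nonneg)
    show "\<forall>\<^sub>F t in at_top. enn2real (?I t) / t < a"
      using order_tendstoD(2)[OF limS a] eventually_gt_at_top[of 0]
    proof eventually_elim
      case (elim t)
      have "enn2real (?I t) / t \<le> (\<Sum>m\<in>arrived R w t. c m) / t"
        using le elim(2) by (intro divide_right_mono) simp_all
      with elim(1) show ?case by linarith
    qed
  qed
  then have "((\<lambda>t. ereal (enn2real (?I t) / t)) \<longlongrightarrow> ereal (width_budget R k)) at_top" by simp
  moreover have "enn2ereal (?I t) = ereal (enn2real (?I t))" for t
    using fin[of t] by (metis enn2ereal_ennreal enn2real_nonneg ennreal_enn2real infinity_ennreal_def)
  ultimately show ?case
    by (elim Lim_transform_eventually) (use eventually_gt_at_top[of 0] in \<open>eventually_elim, simp\<close>)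
qed

section \<open>Optimality\<close>

lemma AE_const: "(AE w in sample R. P) \<longleftrightarrow> P"
proof -
  interpret prob_space "sample R" by (rule prob_space_sample)
  show ?thesis by (simp add: AE_const)
qed

lemma fixed_width_average_jct_unique:
  assumes "fixed_width R k p" "has_average_jct R p T"
  shows "AE w in sample R. T w = ereal (width_jct R k)"
  using assms(2) fixed_width_average_jct[OF assms(1)] unfolding has_average_jct_def
  by eventually_elim (rule tendsto_unique[OF trivial_limit_at_top_linorder])

lemma fixed_width_within_budget:
  assumes "fixed_width R k p"
  shows "within_budget R b p \<longleftrightarrow> width_budget R k \<le> b"
proof
  assume "within_budget R b p"
  then obtain C where C: "has_operating_budget R p C" "AE w in sample R. C w \<le> ereal b"
    by (auto simp: within_budget_def)
  from C(1) fixed_width_operating_budget[OF assms]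
  have "AE w in sample R. C w = ereal (width_budget R k)"
    unfolding has_operating_budget_def
    by eventually_elim (rule tendsto_unique[OF trivial_limit_at_top_linorder])
  with C(2) have "AE w in sample R. width_budget R k \<le> b" by eventually_elim simp
  then show "width_budget R k \<le> b" by (simp add: AE_const)
next
  assume "width_budget R k \<le> b"
  then show "within_budget R b p"
    unfolding within_budget_def using fixed_width_operating_budget[OF assms]
    by (intro exI[of _ "\<lambda>_. ereal (width_budget R k)"]) simp
qed

text \<open>Every family of widths is realized by a policy, and its metrics are almost surely the
  constants in the optimization problem; almost sure comparisons thus become numerical ones.\<close>

lemma BOA_iff_solves:
  assumes p: "fixed_width R k p"
  shows "BOA R b p \<longleftrightarrow> solves (widths R) (width_jct R) (width_budget R) b k"
proof
  assume "BOA R b p"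
  then obtain T where "within_budget R b p" and T: "has_average_jct R p T"
    and opt: "\<And>q l T'. fixed_width R l q \<Longrightarrow> within_budget R b q \<Longrightarrow> has_average_jct R q T' \<Longrightarrow>
      AE w in sample R. T w \<le> T' w"
    unfolding BOA_def minimizes_jct_def by blast
  have "width_jct R k \<le> width_jct R y" if y: "y \<in> widths R" "width_budget R y \<le> b" for y
  proof -
    obtain q where q: "fixed_width R y q" using fixed_width_exists[OF y(1)] by blast
    have "AE w in sample R. T w \<le> ereal (width_jct R y)"
      using opt[OF q _ fixed_width_average_jct[OF q]] fixed_width_within_budget[OF q] y(2) by simp
    with fixed_width_average_jct_unique[OF p T] have "AE w in sample R. width_jct R k \<le> width_jct R y"
      by eventually_elim simp
    then show ?thesis by (simp add: AE_const)
  qed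
  with \<open>within_budget R b p\<close> show "solves (widths R) (width_jct R) (width_budget R) b k"
    using p fixed_width_within_budget[OF p] by (auto simp: solves_def fixed_width_def)
next
  assume k: "solves (widths R) (width_jct R) (width_budget R) b k"
  have "AE w in sample R. ereal (width_jct R k) \<le> T' w"
    if q: "fixed_width R y q" "within_budget R b q" "has_average_jct R q T'" for y q T'
  proof -
    have "y \<in> widths R" using q(1) by (simp add: fixed_width_def)
    then have "width_jct R k \<le> width_jct R y"
      using k q(2) fixed_width_within_budget[OF q(1)] by (auto simp: solves_def)
    then show ?thesis using fixed_width_average_jct_unique[OF q(1,3)] by auto
  qed
  then show "BOA R b p"
    unfolding BOA_def minimizes_jct_def
    using p k fixed_width_within_budget[OF p] fixed_width_average_jct[OF p] by (auto simp: solves_def)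
qed

text \<open>The limits of a competing policy may vary with the path, so the lower bound is applied
  on each regular path separately.\<close>

lemma BOA_optimal:
  assumes "BOA R b p"
  shows "minimizes_jct R b {q. policy R q} p"
proof -
  obtain k where p: "fixed_width R k p" using assms by (auto simp: BOA_def minimizes_jct_def)
  have k: "solves (widths R) (width_jct R) (width_budget R) b k"
    using assms BOA_iff_solves[OF p] by simp
  have "AE w in sample R. ereal (width_jct R k) \<le> T w"
    if q: "policy R q" "within_budget R b q" "has_average_jct R q T" for q T
  proof -
    obtain C where C: "has_operating_budget R q C" "AE w in sample R. C w \<le> ereal b"
      using q(2) by (auto simp: within_budget_def)
    show ?thesis
      using AE_regular C q(3) unfolding has_operating_budget_def has_average_jct_def
    proof eventually_elim
      case (elim w)
      show ?case
        using k by (intro policy_jct_lower_bound[OF elim(1) q(1) elim(2,3,4)]) (simp add: solves_def)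
    qed
  qed
  moreover have "policy R p" using p by (simp add: fixed_width_def)
  moreover have "within_budget R b p" using assms by (simp add: BOA_def minimizes_jct_def)
  ultimately show ?thesis
    unfolding minimizes_jct_def using fixed_width_average_jct[OF p] by auto
qed

end

theorem theorem4p3:
  fixes R :: "('w, 'c::finite) rental" and b :: real
  assumes "gpu_rental R" and "budget_keeps_up R b"
  shows
    \<comment> \<open>the BOA policy is optimal among all policies\<close>
    "(\<forall>p. BOA R b p \<longrightarrow> minimizes_jct R b {q. policy R q} p) \<and>
    \<comment> \<open>the metrics of fixed-width policies\<close>
     (\<forall>k\<in>widths R. (\<exists>p. fixed_width R k p) \<and>
        (\<forall>p. fixed_width R k p \<longrightarrow>
           has_average_jct R p (\<lambda>_. ereal (width_jct R k)) \<and>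
           has_operating_budget R p (\<lambda>_. ereal (width_budget R k)))) \<and>
    \<comment> \<open>the BOA policy is computed by the optimization problem\<close>
     (\<forall>k p. fixed_width R k p \<longrightarrow>
        (BOA R b p \<longleftrightarrow> solves (widths R) (width_jct R) (width_budget R) b k)) \<and>
    \<comment> \<open>the optimization problem is convex after the change of variables to unit times\<close>
     convex_fun (widths R) (width_jct R) \<and>
     convex_problem (feasible_times R) (time_jct R) (time_budget R) \<and>
     {x \<in> feasible_times R. time_budget R x \<le> b} =
       {x. \<exists>k\<in>widths R. width_budget R k \<le> b \<and>
             (\<forall>i. \<forall>j\<in>{1..epochs R i}. x i j = unit_times R k i j)} \<and>
     (\<forall>k\<in>widths R. time_jct R (unit_times R k) = width_jct R k) \<and>
     (\<forall>k\<in>widths R. width_budget R k \<le> b \<longrightarrow>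
        (solves (widths R) (width_jct R) (width_budget R) b k \<longleftrightarrow>
         solves (feasible_times R) (time_jct R) (time_budget R) b (unit_times R k)))"
proof -
  interpret gpu_rental R by (rule assms(1))
  show ?thesis
    using BOA_optimal BOA_iff_solves fixed_width_exists fixed_width_average_jct
      fixed_width_operating_budget convex_width_jct convex_time_problem feasible_set_eq
      time_jct_unit_times solves_iff
    by (intro conjI ballI allI impI) blast+
qed

end
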